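(* Let $E = E(J_0,\{n_k\},\{c_k\},\{\eta_{k,j}\})$ be a homogeneous perfect set. If the sequence $\{n_k\}_{k\ge 1}$ is bounded and $\dim_H E = 1$, then $\dim_H f(E) = 1$ for every $1$-dimensional quasisymmetric map $f:\mathbb{R}\to\mathbb{R}$.
   Context: $|\cdot|$ denotes $1$-dimensional Lebesgue measure (length of an interval), and $\dim_H$ denotes Hausdorff dimension. Quasisymmetric maps. For $M\ge 1$, a homeomorphism $f:\mathbb{R}\to\mathbb{R}$ is $M$-quasisymmetric if $M^{-1}\le \frac{|f(I)|}{|f(J)|}\le M$ for all pairs of adjacent (bounded, nondegenerate) intervals $I,J$ of equal length. A homeomorphism $f:\mathbb{R}\to\mathbb{R}$ is a ($1$-dimensional) quasisymmetric map if it is $M$-quasisymmetric for some $M\ge 1$. Homogeneous perfect sets. Let $J_0=[0,1]$. Let $\{n_k\}_{k\ge1}$ be a sequence of integers with $n_k\ge 2$ and $\{c_k\}_{k\ge1}$ a sequence of real numbers with $0<c_k<1$. For $k\ge 1$ let $D_k=\{(i_1,\dots,i_k): 1\le i_j\le n_j,\ 1\le j\le k\}$, let $D_0=\{0\}$ (a single element, playing the role of the empty word, whose interval is $J_0$), and $D=\bigcup_{k\ge0}D_k$. For $\sigma=(\sigma_1,\dots,\sigma_k)\in D_k$ and $1\le j\le n_{k+1}$ write $\sigma*j=(\sigma_1,\dots,\sigma_k,j)\in D_{k+1}$ (for $\sigma\in D_0$, $\sigma*j=(j)$). A collection $\{J_\sigma:\sigma\in D\}$ of closed subintervals of $J_0$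 has the homogeneous perfect structure if: 1. For every $k\ge0$ and $\sigma\in D_k$, the intervals $J_{\sigma*1},\dots,J_{\sigma*n_{k+1}}$ are subintervals of $J_\sigma$, and $\max J_{\sigma*i}\le \min J_{\sigma*(i+1)}$ for $1\le i\le n_{k+1}-1$ (so they are ordered from left to right and have pairwise disjoint interiors). 2. For every $k\ge1$, $\sigma\in D_{k-1}$ and $1\le j\le n_k$, $\frac{|J_{\sigma*j}|}{|J_\sigma|}=c_k$. 3. There are nonnegative real numbers $\eta_{k,j}$ ($k\ge1$, $0\le j\le n_k$) such that for every $k\ge0$ and $\sigma\in D_k$: $\min J_{\sigma*1}-\min J_\sigma=\eta_{k+1,0}$, $\max J_\sigma-\max J_{\sigma*n_{k+1}}=\eta_{k+1,n_{k+1}}$, and $\min J_{\sigma*(i+1)}-\max J_{\sigma*i}=\eta_{k+1,i}$ for $1\le i\le n_{k+1}-1$. Given such a collection, put $E_k=\bigcup_{\sigma\in D_k}J_\sigma$. The set $E=E(J_0,\{n_k\},\{c_k\},\{\eta_{k,j}\})=\bigcap_{k\ge0}E_k$ is called a homogeneous perfect set. *)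

theory Defs
  imports "HOL-Analysis.Analysis"
begin

section \<open>Hausdorff dimension\<close>

text \<open>The case distinction provides the conventions \<open>0\<^sup>0 = 1\<close> for nonempty sets
  (in the library, \<open>0 powr 0 = 0\<close>) and weight \<open>0\<close> for the empty set, so that the
  \<open>0\<close>-dimensional measure is the counting measure.\<close>

definition hausdorff_weight :: "real \<Rightarrow> 'a::metric_space set \<Rightarrow> ennreal" where
  "hausdorff_weight s U =
     (if U = {} then 0 else if s = 0 then 1 else ennreal (diameter U powr s))"

text \<open>Boundedness has to be required separately, because \<open>diameter\<close> is
  unspecified on unbounded sets.\<close>

definition delta_covers :: "real \<Rightarrow> 'a::metric_space set \<Rightarrow> (nat \<Rightarrow> 'a set) set" where
  "delta_covers \<delta> A =
     {U. A \<subseteq> (\<Union>i. U i) \<and> (\<forall>i. bounded (U i) \<and> diameter (U i) \<le> \<delta>)}"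

definition hausdorff_premeasure :: "real \<Rightarrow> real \<Rightarrow> 'a::metric_space set \<Rightarrow> ennreal" where
  "hausdorff_premeasure s \<delta> A = (INF U\<in>delta_covers \<delta> A. \<Sum>i. hausdorff_weight s (U i))"

definition hausdorff_measure :: "real \<Rightarrow> 'a::metric_space set \<Rightarrow> ennreal" where
  "hausdorff_measure s A = (SUP \<delta>\<in>{0<..}. hausdorff_premeasure s \<delta> A)"

definition hausdorff_dim :: "'a::metric_space set \<Rightarrow> ennreal" where
  "hausdorff_dim A = (INF s\<in>{s. 0 \<le> s \<and> hausdorff_measure s A = 0}. ennreal s)"


section \<open>Quasisymmetric maps of the line\<close>

text \<open>Any combination of open and closed ends is allowed; adjacent intervals
  may or may not contain the endpoint at which they meet.\<close>

definition nondegenerate_interval :: "real set \<Rightarrow> bool" where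
  "nondegenerate_interval I \<longleftrightarrow> is_interval I \<and> bounded I \<and> interior I \<noteq> {}"

definition adjacent_intervals :: "real set \<Rightarrow> real set \<Rightarrow> bool" where
  "adjacent_intervals I J \<longleftrightarrow>
     nondegenerate_interval I \<and> nondegenerate_interval J \<and> (Sup I = Inf J \<or> Sup J = Inf I)"

definition M_quasisymmetric :: "real \<Rightarrow> (real \<Rightarrow> real) \<Rightarrow> bool" where
  "M_quasisymmetric M f \<longleftrightarrow>
     (\<exists>g. homeomorphism UNIV UNIV f g) \<and>
     (\<forall>I J. adjacent_intervals I J \<and> measure lborel I = measure lborel J \<longrightarrow>
        inverse M \<le> measure lborel (f ` I) / measure lborel (f ` J) \<and>
        measure lborel (f ` I) / measure lborel (f ` J) \<le> M)"

definition quasisymmetric :: "(real \<Rightarrow> real) \<Rightarrow> bool" where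
  "quasisymmetric f \<longleftrightarrow> (\<exists>M\<ge>1. M_quasisymmetric M f)"


section \<open>Homogeneous perfect sets\<close>

text \<open>Words are lists. Letters and levels are counted from \<open>1\<close>, so the letter
  \<open>\<sigma> ! j\<close> belongs to level \<open>Suc j\<close>, and the values at index \<open>0\<close> of the
  sequences \<open>n\<close>, \<open>c\<close>, \<open>\<eta>\<close> below play no role. The word \<open>\<sigma>\<close> extended by the letter
  \<open>j\<close> is \<open>\<sigma> @ [j]\<close>.\<close>

definition words :: "(nat \<Rightarrow> nat) \<Rightarrow> nat \<Rightarrow> nat list set" where
  "words n k = {\<sigma>. length \<sigma> = k \<and> (\<forall>j<k. \<sigma> ! j \<in> {1..n (Suc j)})}"

text \<open>Since each \<open>J \<sigma>\<close> is a nonempty compact interval, \<open>Inf\<close> and \<open>Sup\<close> are its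
  minimum and maximum.\<close>

locale homogeneous_perfect_structure =
  fixes n :: "nat \<Rightarrow> nat"
    and c :: "nat \<Rightarrow> real"
    and \<eta> :: "nat \<Rightarrow> nat \<Rightarrow> real"
    and J :: "nat list \<Rightarrow> real set"
  assumes n_ge_2: "k \<ge> 1 \<Longrightarrow> n k \<ge> 2"
    and c_bounds: "k \<ge> 1 \<Longrightarrow> 0 < c k \<and> c k < 1"
    and eta_nonneg: "k \<ge> 1 \<Longrightarrow> j \<le> n k \<Longrightarrow> 0 \<le> \<eta> k j"
    and J_Nil: "J [] = {0..1}"
    and J_interval: "\<sigma> \<in> words n k \<Longrightarrow> \<exists>a b. a \<le> b \<and> J \<sigma> = {a..b}"
    and J_subset: "\<sigma> \<in> words n k \<Longrightarrow> j \<in> {1..n (Suc k)} \<Longrightarrow> J (\<sigma> @ [j]) \<subseteq> J \<sigma>"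
    and J_ordered: "\<sigma> \<in> words n k \<Longrightarrow> i \<in> {1..<n (Suc k)} \<Longrightarrow>
          Sup (J (\<sigma> @ [i])) \<le> Inf (J (\<sigma> @ [Suc i]))"
    and J_ratio: "\<sigma> \<in> words n k \<Longrightarrow> j \<in> {1..n (Suc k)} \<Longrightarrow>
          measure lborel (J (\<sigma> @ [j])) / measure lborel (J \<sigma>) = c (Suc k)"
    and gap_left: "\<sigma> \<in> words n k \<Longrightarrow> Inf (J (\<sigma> @ [1])) - Inf (J \<sigma>) = \<eta> (Suc k) 0"
    and gap_right: "\<sigma> \<in> words n k \<Longrightarrow>
          Sup (J \<sigma>) - Sup (J (\<sigma> @ [n (Suc k)])) = \<eta> (Suc k) (n (Suc k))"
    and gap_between: "\<sigma> \<in> words n k \<Longrightarrow> i \<in> {1..<n (Suc k)} \<Longrightarrow>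
          Inf (J (\<sigma> @ [Suc i])) - Sup (J (\<sigma> @ [i])) = \<eta> (Suc k) i"

definition level_set :: "(nat \<Rightarrow> nat) \<Rightarrow> (nat list \<Rightarrow> real set) \<Rightarrow> nat \<Rightarrow> real set" where
  "level_set n J k = (\<Union>\<sigma>\<in>words n k. J \<sigma>)"

definition homogeneous_perfect_set :: "(nat \<Rightarrow> nat) \<Rightarrow> (nat list \<Rightarrow> real set) \<Rightarrow> real set" where
  "homogeneous_perfect_set n J = (\<Inter>k. level_set n J k)"

end

theory Submission
  imports Defs
begin

text \<open>Write \<open>p\<^sub>i = n\<^sub>i c\<^sub>i \<le> 1\<close>. Covering \<open>E\<close> by its level intervals, \<open>dim E = 1\<close> and boundedness
  of \<open>n\<close> force \<open>- ln (p\<^sub>1 \<dots> p\<^sub>k) = o(k)\<close>, so that at most levels the gaps are relatively small.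
  A quasisymmetric \<open>f\<close> distorts the relative length of a subinterval at most polynomially,
  hence for \<open>d < 1\<close> passing from an interval \<open>J\<close> to its children multiplies the sum of the
  \<open>|f(J)|\<^sup>d\<close> by at least \<open>e\<^sup>\<kappa> p\<^sup>L\<close> with fixed \<open>\<kappa>, L > 0\<close>: it is a gain when the gaps are
  small, by strict concavity, and at worst a power of \<open>p\<close> otherwise. Distributing mass in
  proportion to \<open>|f(J)|\<^sup>d\<close> then gives \<open>J\<close> a mass at most a constant times \<open>|f(J)|\<^sup>d\<close>, and the mass
  distribution principle yields \<open>dim f(E) \<ge> d\<close>.\<close>

section \<open>Hausdorff measure and dimension\<close>

text \<open>The finite family is enumerated and padded with empty sets, which cost nothing because
  \<open>hausdorff_weight\<close> vanishes on them even for \<open>s = 0\<close>.\<close>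

lemma hausdorff_premeasure_finite_cover:
  fixes V :: "'b \<Rightarrow> 'a::metric_space set"
  assumes "finite I" "A \<subseteq> (\<Union>i\<in>I. V i)" "0 \<le> \<delta>"
    and "\<And>i. i \<in> I \<Longrightarrow> bounded (V i) \<and> diameter (V i) \<le> \<delta>"
  shows "hausdorff_premeasure s \<delta> A \<le> (\<Sum>i\<in>I. hausdorff_weight s (V i))"
proof -
  obtain e where e: "bij_betw e {..<card I} I"
    using ex_bij_betw_nat_finite[OF \<open>finite I\<close>] by (auto simp: atLeast0LessThan)
  define U where "U i = (if i < card I then V (e i) else {})" for i
  have eI: "e i \<in> I" if "i < card I" for i
    using e that by (auto simp: bij_betw_def)
  have "A \<subseteq> (\<Union>i. U i)"
  proof
    fix x assume "x \<in> A"
    then obtain i where "i \<in> I" "x \<in> V i" using assms(2) by blast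
    then obtain j where "j < card I" "e j = i"
      using e by (metis bij_betw_def image_iff lessThan_iff)
    then show "x \<in> (\<Union>i. U i)"
      using \<open>x \<in> V i\<close> by (auto simp: U_def)
  qed
  then have "U \<in> delta_covers \<delta> A"
    using assms(3,4) eI by (auto simp: delta_covers_def U_def)
  then have "hausdorff_premeasure s \<delta> A \<le> (\<Sum>i. hausdorff_weight s (U i))"
    unfolding hausdorff_premeasure_def by (rule INF_lower)
  also have "\<dots> = (\<Sum>i<card I. hausdorff_weight s (U i))"
    by (rule suminf_finite) (auto simp: U_def hausdorff_weight_def)
  also have "\<dots> = (\<Sum>i<card I. hausdorff_weight s (V (e i)))"
    by (simp add: U_def)
  also have "\<dots> = (\<Sum>i\<in>I. hausdorff_weight s (V i))"
    by (rule sum.reindex_bij_betw[OF e])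
  finally show ?thesis .
qed

text \<open>Serves covers by sets with one common diameter bound \<open>l\<close>: grids of a
  bounded set and the level intervals of \<open>E\<close>. The condition \<open>0 < s\<close> keeps
  the weight \<open>1\<close> of the counting measure out.\<close>

lemma hausdorff_measure_eq_0I:
  fixes A :: "'a::metric_space set"
  assumes "0 < s"
    and cover: "\<And>\<delta> \<epsilon>. 0 < \<delta> \<Longrightarrow> 0 < \<epsilon> \<Longrightarrow> \<exists>(I :: 'b set) V l. finite I \<and> A \<subseteq> (\<Union>i\<in>I. V i) \<and>
      (\<forall>i\<in>I. bounded (V i) \<and> diameter (V i) \<le> l) \<and> 0 \<le> l \<and> l \<le> \<delta> \<and>
      real (card I) * l powr s \<le> \<epsilon>"
  shows "hausdorff_measure s A = 0"
proof -
  have "hausdorff_premeasure s \<delta> A \<le> 0" if "0 < \<delta>" for \<delta> :: real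
  proof (rule ennreal_le_epsilon)
    fix \<epsilon> :: real assume "0 < \<epsilon>"
    obtain I :: "'b set" and V l where *: "finite I" "A \<subseteq> (\<Union>i\<in>I. V i)"
        "\<And>i. i \<in> I \<Longrightarrow> bounded (V i) \<and> diameter (V i) \<le> l" "0 \<le> l" "l \<le> \<delta>"
        "real (card I) * l powr s \<le> \<epsilon>"
      using cover[OF \<open>0 < \<delta>\<close> \<open>0 < \<epsilon>\<close>] by metis
    have "hausdorff_premeasure s \<delta> A \<le> (\<Sum>i\<in>I. hausdorff_weight s (V i))"
      using * by (intro hausdorff_premeasure_finite_cover) force+
    also have "\<dots> \<le> (\<Sum>i\<in>I. ennreal (l powr s))"
      using *(3) \<open>0 < s\<close>
      by (intro sum_mono) (auto simp: hausdorff_weight_def intro!: ennreal_leI powr_mono2 diameter_ge_0)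
    also have "\<dots> = ennreal (real (card I) * l powr s)"
      by (simp add: ennreal_mult ennreal_of_nat_eq_real_of_nat)
    also have "\<dots> \<le> 0 + ennreal \<epsilon>"
      using *(6) by (simp add: ennreal_leI)
    finally show "hausdorff_premeasure s \<delta> A \<le> 0 + ennreal \<epsilon>" .
  qed
  then show ?thesis
    unfolding hausdorff_measure_def by (simp add: SUP_le_iff flip: le_zero_eq)
qed

lemma hausdorff_dim_le:
  "0 \<le> s \<Longrightarrow> hausdorff_measure s A = 0 \<Longrightarrow> hausdorff_dim A \<le> ennreal s"
  unfolding hausdorff_dim_def by (rule INF_lower) simp

lemma hausdorff_dim_bounded_real_le_1:
  fixes A :: "real set"
  assumes "bounded A"
  shows "hausdorff_dim A \<le> 1"
proof -
  obtain R where R: "0 < R" "A \<subseteq> {-R..R}"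
    using assms by (metis bounded_pos real_norm_def abs_le_iff atLeastAtMost_iff minus_le_iff subsetI)
  have "hausdorff_dim A \<le> 1 + ennreal e" if "0 < e" for e
  proof -
    have "hausdorff_measure (1 + e) A = 0"
    proof (rule hausdorff_measure_eq_0I[where 'b = nat])
      fix \<delta> \<epsilon> :: real assume "0 < \<delta>" "0 < \<epsilon>"
      define l where "l m = 2 * R / real m" for m
      have l_nonneg: "0 \<le> l m" for m using R(1) by (simp add: l_def)
      have "l \<longlonglongrightarrow> 0"
        unfolding l_def by (rule real_tendsto_divide_at_top[OF tendsto_const filterlim_real_sequentially])
      moreover from this have "(\<lambda>m. 4 * R * l m powr e) \<longlonglongrightarrow> 4 * R * 0 powr e"
        using \<open>0 < e\<close> R(1)
        by (intro tendsto_mult tendsto_const tendsto_powr2) (auto simp: l_nonneg)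
      ultimately have "\<forall>\<^sub>F m in sequentially. l m < \<delta> \<and> 4 * R * l m powr e < \<epsilon> \<and> m > 0"
        using \<open>0 < \<delta>\<close> \<open>0 < \<epsilon>\<close>
        by (intro eventually_conj eventually_gt_at_top) (auto dest: order_tendstoD)
      then obtain m where m: "l m < \<delta>" "4 * R * l m powr e < \<epsilon>" "m > 0"
        using eventually_happens'[OF sequentially_bot] by blast
      have lm: "0 < l m" using R m by (simp add: l_def)
      define V where "V i = {- R + real i * l m..- R + real (Suc i) * l m}" for i
      \<comment> \<open>Besides \<open>m\<close> grid intervals of length \<open>2 * R / m\<close>
        there is one more, for the right end \<open>x = R\<close>, whose floor is
        \<open>m\<close>.\<close>
      have "A \<subseteq> (\<Union>i\<in>{..m}. V i)"
      proof
        fix x assume "x \<in> A"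
        with R have x: "0 \<le> x + R" "x + R \<le> real m * l m" using m by (auto simp: l_def)
        define i where "i = nat \<lfloor>(x + R) / l m\<rfloor>"
        have "real i \<le> (x + R) / l m" "(x + R) / l m \<le> real i + 1"
          using x lm unfolding i_def by auto
        moreover have "i \<le> m"
          using x lm unfolding i_def by (simp add: floor_le_iff nat_le_iff pos_divide_less_eq algebra_simps)
        ultimately show "x \<in> (\<Union>i\<in>{..m}. V i)"
          using lm by (auto simp: V_def field_simps intro!: bexI[of _ i])
      qed
      show "\<exists>I V l. finite (I :: nat set) \<and> A \<subseteq> (\<Union>i\<in>I. V i) \<and>
          (\<forall>i\<in>I. bounded (V i) \<and> diameter (V i) \<le> l) \<and> 0 \<le> l \<and> l \<le> \<delta> \<and>
          real (card I) * l powr (1 + e) \<le> \<epsilon>"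
      proof (intro exI conjI ballI)
        have "real (card {..m}) * l m powr (1 + e) \<le> (2 * real m) * (l m * l m powr e)"
          using m lm by (intro mult_mono) (auto simp: powr_add)
        also have "\<dots> = 4 * R * l m powr e"
          using m by (simp add: l_def)
        finally show "real (card {..m}) * l m powr (1 + e) \<le> \<epsilon>" using m by simp
      next
        fix i assume "i \<in> {..m}"
        show "diameter (V i) \<le> l m"
          using lm by (simp add: V_def diameter_closed_interval algebra_simps)
      qed (use \<open>A \<subseteq> (\<Union>i\<in>{..m}. V i)\<close> m lm in \<open>auto simp: V_def\<close>)
    qed (use that in auto)
    then show ?thesis
      using hausdorff_dim_le[of "1 + e" A] that by simp
  qed
  then show ?thesis by (rule ennreal_le_epsilon)
qed

section \<open>Distortion of intervals\<close>

text \<open>Only the closed intervals \<open>[a, a + h]\<close> and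
  \<open>[a + h, a + 2 * h]\<close> are compared, and the quotients are cleared of division.
  Decreasing maps are reduced to this case in \<open>quasisymmetric_cases\<close>.\<close>

locale increasing_quasisymmetric =
  fixes f :: "real \<Rightarrow> real" and M :: real
  assumes strict_mono: "strict_mono f"
    and surj: "surj f"
    and M_ge_1: "1 \<le> M"
    and right_le_left: "0 < h \<Longrightarrow> f (a + 2 * h) - f (a + h) \<le> M * (f (a + h) - f a)"
    and left_le_right: "0 < h \<Longrightarrow> f (a + h) - f a \<le> M * (f (a + 2 * h) - f (a + h))"
begin

lemma f_le: "x \<le> y \<Longrightarrow> f x \<le> f y"
  using strict_mono by (simp add: strict_mono_less_eq)

lemma f_less: "x < y \<Longrightarrow> f x < f y"
  using strict_mono by (simp add: strict_monoD)

text \<open>Doubling an interval to the right adds at most \<open>M\<close> times its image, so each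
  doubling costs a factor \<open>M + 1\<close>. The next lemma is the mirror image.\<close>

lemma growth_right:
  assumes "0 < h"
  shows "f (a + 2 ^ m * h) - f a \<le> (M + 1) ^ m * (f (a + h) - f a)"
proof (induction m)
  case (Suc m)
  let ?H = "2 ^ m * h"
  have "f (a + 2 * ?H) - f a \<le> (M + 1) * (f (a + ?H) - f a)"
    using right_le_left[of ?H a] assms by (simp add: algebra_simps)
  also have "\<dots> \<le> (M + 1) * ((M + 1) ^ m * (f (a + h) - f a))"
    using Suc M_ge_1 by (intro mult_left_mono) auto
  finally show ?case by (simp add: mult_ac)
qed simp

lemma growth_left:
  assumes "0 < h"
  shows "f b - f (b - 2 ^ m * h) \<le> (M + 1) ^ m * (f b - f (b - h))"
proof (induction m)
  case (Suc m)
  let ?H = "2 ^ m * h"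
  have "f b - f (b - 2 * ?H) \<le> (M + 1) * (f b - f (b - ?H))"
    using left_le_right[of ?H "b - 2 * ?H"] assms by (simp add: algebra_simps)
  also have "\<dots> \<le> (M + 1) * ((M + 1) ^ m * (f b - f (b - h)))"
    using Suc M_ge_1 by (intro mult_left_mono) auto
  finally show ?case by (simp add: mult_ac)
qed simp

text \<open>Growing \<open>[u, v]\<close> by the factor \<open>2 ^ m\<close> once from
  \<open>u\<close> to the right and once from \<open>v\<close> to the left covers
  \<open>[x, y]\<close>; the two estimates add up, whence the factor \<open>2\<close>.\<close>

lemma image_le_subinterval:
  assumes "x \<le> u" "u < v" "v \<le> y" "y - x \<le> 2 ^ m * (v - u)"
  shows "f y - f x \<le> 2 * (M + 1) ^ m * (f v - f u)"
proof -
  have "f y \<le> f (u + 2 ^ m * (v - u))" "f (v - 2 ^ m * (v - u)) \<le> f x"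
    using assms by (intro f_le; linarith)+
  moreover have "f u \<le> f v" using assms by (intro f_le) simp
  ultimately show ?thesis
    using growth_right[of "v - u" u m] growth_left[of "v - u" v m] assms(2) by simp
qed

text \<open>Doubling \<open>[u, v]\<close> inside \<open>[x, y]\<close> adds an image at least
  \<open>1 / M\<close> times the old one, so the old image is at most \<open>M / (M + 1)\<close> of
  the new. The base \<open>3\<close> instead of \<open>2\<close> guarantees room for the doubling on
  one of the two sides.\<close>

lemma subinterval_image_le_power:
  assumes "x \<le> u" "u \<le> v" "v \<le> y" "3 ^ m * (v - u) \<le> y - x"
  shows "f v - f u \<le> (M / (M + 1)) ^ m * (f y - f x)"
  using assms
proof (induction m arbitrary: u v)
  case 0
  then show ?case using f_le[of v y] f_le[of x u] by simp
next
  case (Suc m)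
  show ?case
  proof (cases "u = v")
    case True
    then show ?thesis using f_le[of x y] Suc.prems M_ge_1 by simp
  next
    case False
    define h where "h = v - u"
    have h: "0 < h" "v = u + h" using False Suc.prems by (auto simp: h_def)
    have step: "f (u + h) - f u \<le> M / (M + 1) * (f v' - f u')"
      if "f (u + h) - f u \<le> M * (f v' - f u' - (f (u + h) - f u))" for u' v'
      using that M_ge_1 by (simp add: field_simps)
    have "3 * (3 ^ m * h) \<le> y - x" using Suc.prems(4) h by simp
    moreover have "h \<le> 3 ^ m * h" using h by simp
    ultimately have small: "3 ^ m * (2 * h) \<le> y - x" "3 * h \<le> y - x" using h by linarith+
    have "\<exists>u' v'. x \<le> u' \<and> v' \<le> y \<and> v' - u' = 2 * h \<and>
        f (u + h) - f u \<le> M * (f v' - f u' - (f (u + h) - f u))"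
    \<comment> \<open>If there is no room on the right, then \<open>3 * h \<le> y - x\<close> leaves
      room on the left.\<close>
    proof (cases "u + 2 * h \<le> y")
      case True
      then show ?thesis
        using left_le_right[OF h(1), of u] Suc.prems by (intro exI[of _ u] exI[of _ "u + 2 * h"]) auto
    next
      case False
      then show ?thesis
        using right_le_left[OF h(1), of "u - h"] Suc.prems small h
        by (intro exI[of _ "u - h"] exI[of _ "u + h"]) (auto simp: algebra_simps)
    qed
    then obtain u' v' where u'v': "x \<le> u'" "v' \<le> y" "v' - u' = 2 * h"
        "f (u + h) - f u \<le> M * (f v' - f u' - (f (u + h) - f u))" by blast
    have "f v - f u \<le> M / (M + 1) * (f v' - f u')"
      using step[OF u'v'(4)] h by simp
    also have "\<dots> \<le> M / (M + 1) * ((M / (M + 1)) ^ m * (f y - f x))"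
      using u'v' h small M_ge_1 by (intro mult_left_mono Suc.IH) auto
    finally show ?thesis by (simp add: mult_ac)
  qed
qed

text \<open>Apply \<open>image_le_subinterval\<close> with the least \<open>m\<close> such that
  \<open>2 ^ m\<close> reaches \<open>(y - x) / (v - u)\<close>. Then \<open>(M + 1) ^ m\<close> is
  a power of this quotient with exponent \<open>log 2 (M + 1)\<close>, up to a factor
  \<open>M + 1\<close> from rounding that \<open>C\<close> absorbs.\<close>

lemma subinterval_image_ge_powr:
  obtains C L where "0 < C" "0 \<le> L"
    "\<And>x u v y. x \<le> u \<Longrightarrow> u < v \<Longrightarrow> v \<le> y \<Longrightarrow>
        C * ((v - u) / (y - x)) powr L * (f y - f x) \<le> f v - f u"
proof
  define L where "L = log 2 (M + 1)"
  define C where "C = 1 / (2 * (M + 1))"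
  show "0 < C" "0 \<le> L" using M_ge_1 by (auto simp: C_def L_def)
  fix x u v y :: real assume *: "x \<le> u" "u < v" "v \<le> y"
  define t where "t = (v - u) / (y - x)"
  have t: "0 < t" "t \<le> 1" using * by (auto simp: t_def)
  define m where "m = nat \<lceil>log 2 (1 / t)\<rceil>"
  have log: "0 \<le> log 2 (1 / t)" using t by simp
  then have "log 2 (1 / t) \<le> real m" "real m \<le> 1 + log 2 (1 / t)"
    unfolding m_def by linarith+
  have "1 / t = 2 powr (log 2 (1 / t))" using t by simp
  also have "\<dots> \<le> 2 powr m" using \<open>log 2 (1 / t) \<le> real m\<close> by simp
  finally have "y - x \<le> 2 ^ m * (v - u)"
    using t * by (simp add: t_def powr_realpow field_simps)
  then have "f y - f x \<le> 2 * (M + 1) ^ m * (f v - f u)"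
    using * by (intro image_le_subinterval) auto
  moreover have "(M + 1) ^ m \<le> (M + 1) * t powr - L"
  proof -
    have "(M + 1) ^ m = (M + 1) powr m" using M_ge_1 by (simp add: powr_realpow)
    also have "\<dots> \<le> (M + 1) powr (1 + log 2 (1 / t))"
      using \<open>real m \<le> 1 + log 2 (1 / t)\<close> M_ge_1 by (intro powr_mono) auto
    also have "\<dots> = (M + 1) * (2 powr L) powr (log 2 (1 / t))"
      using M_ge_1 by (simp add: powr_add L_def)
    also have "(2 powr L) powr (log 2 (1 / t)) = (2 powr (log 2 (1 / t))) powr L"
      by (simp only: powr_powr mult.commute)
    also have "\<dots> = t powr - L" using t by (simp add: powr_divide powr_minus_divide)
    finally show ?thesis .
  qed
  moreover have "0 \<le> f v - f u" using f_le[of u v] * by simp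
  ultimately have "f y - f x \<le> 2 * ((M + 1) * t powr - L) * (f v - f u)"
    by (smt (verit) mult_right_mono mult_left_mono)
  then show "C * ((v - u) / (y - x)) powr L * (f y - f x) \<le> f v - f u"
    using t M_ge_1 unfolding t_def[symmetric] C_def by (simp add: powr_minus field_simps)
qed

end

section \<open>Subdivisions of an interval\<close>

text \<open>A telescoping sum. It is used with the identity for \<open>G\<close> to measure lengths,
  and with \<open>f\<close> to measure images.\<close>

lemma sum_gaps_plus_sum_lengths:
  fixes G :: "real \<Rightarrow> real"
  shows "(\<Sum>j\<le>n. G (u (Suc j)) - G (v j)) + (\<Sum>j\<in>{1..n}. G (v j) - G (u j)) =
    G (u (Suc n)) - G (v 0)"
  by (induction n) auto

text \<open>One generation of the construction, detached from words: \<open>[x, y]\<close> is the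
  parent and \<open>u 1, ..., u n\<close> are the left ends of its children, all of relative length
  \<open>c\<close>.\<close>

definition subdivision :: "nat \<Rightarrow> real \<Rightarrow> (nat \<Rightarrow> real) \<Rightarrow> real \<Rightarrow> real \<Rightarrow> bool" where
  "subdivision n c u x y \<longleftrightarrow> x < y \<and> 2 \<le> n \<and> 0 < c \<and> x \<le> u 1 \<and> u n + c * (y - x) \<le> y \<and>
     (\<forall>j\<in>{1..<n}. u j + c * (y - x) \<le> u (Suc j))"

text \<open>With the ends of the parent added as \<open>b 0\<close> and \<open>a (Suc n)\<close>,
  all gaps, outer ones included, are the intervals from \<open>b j\<close> to
  \<open>a (Suc j)\<close>. Their lengths are nonnegative and sum to
  \<open>(1 - real n * c) * (y - x)\<close>, which bounds each of them and forces
  \<open>real n * c \<le> 1\<close>.\<close>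

lemma subdivision_gaps:
  assumes "subdivision n c u x y"
  obtains a b where "\<And>j. j \<le> n \<Longrightarrow> b j \<le> a (Suc j)"
    and "a (Suc n) = y" "b 0 = x"
    and "\<And>j. j \<in> {1..n} \<Longrightarrow> a j = u j \<and> b j = u j + c * (y - x)"
    and "\<And>j. j \<le> n \<Longrightarrow> a (Suc j) - b j \<le> (1 - real n * c) * (y - x)"
    and "real n * c \<le> 1"
proof -
  define a where "a j = (if j = Suc n then y else u j)" for j
  define b where "b j = (if j = 0 then x else u j + c * (y - x))" for j
  have le: "b j \<le> a (Suc j)" if "j \<le> n" for j
    using assms that by (cases "j = n"; cases "j = 0") (auto simp: subdivision_def a_def b_def)
  have ab: "a (Suc n) = y" "b 0 = x" "\<And>j. j \<in> {1..n} \<Longrightarrow> a j = u j \<and> b j = u j + c * (y - x)"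
    by (auto simp: a_def b_def)
  have "(\<Sum>j\<in>{1..n}. b j - a j) = real n * (c * (y - x))"
    using ab(3) by simp
  with sum_gaps_plus_sum_lengths[of "\<lambda>x. x" a b n] ab
  have gaps: "(\<Sum>j\<le>n. a (Suc j) - b j) = (1 - real n * c) * (y - x)"
    by (simp add: algebra_simps)
  have gap: "a (Suc j) - b j \<le> (1 - real n * c) * (y - x)" if "j \<le> n" for j
    unfolding gaps[symmetric] using that le by (intro member_le_sum) auto
  have "0 \<le> (1 - real n * c) * (y - x)"
    unfolding gaps[symmetric] using le by (intro sum_nonneg) auto
  then have "real n * c \<le> 1" using assms by (auto simp: subdivision_def zero_le_mult_iff)
  from that[OF le ab gap this] show thesis .
qed

lemma subdivision_ordered:
  assumes "subdivision n c u x y" "1 \<le> i" "i < j" "j \<le> n"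
  shows "u i + c * (y - x) \<le> u j"
  using assms(3,4)
proof (induction j)
  case (Suc j)
  have step: "u j + c * (y - x) \<le> u (Suc j)"
    using assms Suc.prems by (auto simp: subdivision_def)
  have "0 < c * (y - x)" using assms by (simp add: subdivision_def)
  then show ?case using step Suc by (cases "i = j") auto
qed simp

lemma subdivision_bounds:
  assumes "subdivision n c u x y" "j \<in> {1..n}"
  shows "x \<le> u j" "u j + c * (y - x) \<le> y"
proof -
  have "0 < c * (y - x)" using assms by (simp add: subdivision_def)
  moreover have "x \<le> u 1" "u n + c * (y - x) \<le> y" using assms by (auto simp: subdivision_def)
  ultimately show "x \<le> u j" "u j + c * (y - x) \<le> y"
    using subdivision_ordered[OF assms(1), of 1 j] subdivision_ordered[OF assms(1), of j n] assms(2)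
    by (cases "j = 1"; cases "j = n"; auto)+
qed

section \<open>Image masses of the pieces of a subdivision\<close>

context increasing_quasisymmetric
begin

text \<open>The case of small gaps. The images of the gaps fill at most the proportion
  \<open>\<gamma>\<close>. Since there is a second child with proportion at least
  \<open>\<beta>\<close>, no child exceeds the proportion \<open>1 - \<beta>\<close>, and
  \<open>t powr d = t powr (d - 1) * t\<close> with \<open>d - 1 < 0\<close> turns this into the
  gain \<open>(1 - \<beta>) powr (d - 1)\<close>.\<close>

lemma subdivision_image_mass:
  assumes sub: "subdivision n c u x y" and "n \<le> N"
    and \<beta>: "0 < \<beta>" "\<beta> < 1"
    and large: "\<And>j. j \<in> {1..n} \<Longrightarrow> \<beta> * (f y - f x) \<le> f (u j + c * (y - x)) - f (u j)"
    and m: "3 ^ m * (1 - real n * c) \<le> 1"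
    and d: "0 < d" "d < 1"
    and \<gamma>: "real (N + 1) * (M / (M + 1)) ^ m \<le> \<gamma>"
  shows "(1 - \<gamma>) * (1 - \<beta>) powr (d - 1) * (f y - f x) powr d
    \<le> (\<Sum>j\<in>{1..n}. (f (u j + c * (y - x)) - f (u j)) powr d)"
proof -
  from subdivision_gaps[OF sub] obtain a b where ab:
    "\<And>j. j \<le> n \<Longrightarrow> b j \<le> a (Suc j)" "a (Suc n) = y" "b 0 = x"
    "\<And>j. j \<in> {1..n} \<Longrightarrow> a j = u j \<and> b j = u j + c * (y - x)"
    "\<And>j. j \<le> n \<Longrightarrow> a (Suc j) - b j \<le> (1 - real n * c) * (y - x)"
    by metis
  define \<phi> where "\<phi> j = f (u j + c * (y - x)) - f (u j)" for j
  have "x < y" "2 \<le> n" "0 < c" using sub by (auto simp: subdivision_def)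
  define F where "F = f y - f x"
  have "0 < F" using f_less[OF \<open>x < y\<close>] by (simp add: F_def)
  note bounds = subdivision_bounds[OF sub]
  have ends: "x \<le> b j \<and> a (Suc j) \<le> y" if "j \<le> n" for j
  proof
    have "0 \<le> c * (y - x)" using \<open>x < y\<close> \<open>0 < c\<close> by simp
    then show "x \<le> b j" using that ab(3) ab(4)[of j] bounds(1)[of j] by (cases "j = 0") auto
    show "a (Suc j) \<le> y"
      using that \<open>0 \<le> c * (y - x)\<close> ab(2) ab(4)[of "Suc j"] bounds(2)[of "Suc j"] by (cases "j = n") auto
  qed
  \<comment> \<open>By \<open>m\<close>, every one of the \<open>n + 1\<close> gaps has relative
    length at most \<open>1 / 3 ^ m\<close>.\<close>
  have "(\<Sum>j\<le>n. f (a (Suc j)) - f (b j)) \<le> (\<Sum>j\<le>n. (M / (M + 1)) ^ m * F)"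
  proof (rule sum_mono)
    fix j assume "j \<in> {..n}"
    then have j: "j \<le> n" by simp
    have "3 ^ m * (a (Suc j) - b j) \<le> 3 ^ m * ((1 - real n * c) * (y - x))"
      using ab(5)[OF j] by simp
    also have "\<dots> \<le> y - x"
      using mult_right_mono[OF m, of "y - x"] \<open>x < y\<close> by (simp add: mult_ac)
    finally show "f (a (Suc j)) - f (b j) \<le> (M / (M + 1)) ^ m * F"
      unfolding F_def using ends[OF j] ab(1)[OF j] by (intro subinterval_image_le_power) auto
  qed
  also have "\<dots> = real (n + 1) * (M / (M + 1)) ^ m * F" by simp
  also have "\<dots> \<le> real (N + 1) * (M / (M + 1)) ^ m * F"
    using \<open>n \<le> N\<close> M_ge_1 \<open>0 < F\<close> by (intro mult_right_mono) auto
  also have "\<dots> \<le> \<gamma> * F" using \<gamma> \<open>0 < F\<close> by (intro mult_right_mono) auto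
  finally have "(1 - \<gamma>) * F \<le> (\<Sum>j\<in>{1..n}. f (b j) - f (a j))"
    using sum_gaps_plus_sum_lengths[of f a b n] ab(2,3) by (simp add: F_def algebra_simps)
  also have "\<dots> = (\<Sum>j\<in>{1..n}. \<phi> j)" using ab(4) by (intro sum.cong) (auto simp: \<phi>_def)
  finally have total: "(1 - \<gamma>) * F \<le> (\<Sum>j\<in>{1..n}. \<phi> j)" .
  have pos: "0 < \<phi> j" for j unfolding \<phi>_def using f_less \<open>x < y\<close> \<open>0 < c\<close> by simp
  have two: "\<phi> i + \<phi> j \<le> F" if "i \<in> {1..n}" "j \<in> {1..n}" "i < j" for i j
    using f_le[OF bounds(1)[OF that(1)]] f_le[OF bounds(2)[OF that(2)]]
      f_le[OF subdivision_ordered[OF sub, of i j]] that by (simp add: \<phi>_def F_def)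
  have small: "\<phi> j \<le> (1 - \<beta>) * F" if "j \<in> {1..n}" for j
  proof -
    obtain i where i: "i \<in> {1..n}" "i \<noteq> j"
      using \<open>2 \<le> n\<close> that[of "if j = 1 then 2 else 1"] by (auto split: if_splits)
    have "\<phi> i + \<phi> j \<le> F"
      using two[of i j] two[of j i] i that by (cases "i < j") auto
    then show ?thesis using large[OF i(1)] by (simp add: \<phi>_def F_def algebra_simps)
  qed
  have "(1 - \<gamma>) * (1 - \<beta>) powr (d - 1) * F powr d = ((1 - \<beta>) * F) powr (d - 1) * ((1 - \<gamma>) * F)"
    using \<beta> \<open>0 < F\<close> by (simp add: powr_mult powr_diff)
  also have "\<dots> \<le> ((1 - \<beta>) * F) powr (d - 1) * (\<Sum>j\<in>{1..n}. \<phi> j)"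
    using total by (intro mult_left_mono) auto
  also have "\<dots> \<le> (\<Sum>j\<in>{1..n}. \<phi> j powr (d - 1) * \<phi> j)"
    unfolding sum_distrib_left
    using pos small d by (intro sum_mono mult_right_mono powr_mono2') (auto simp: less_imp_le)
  also have "\<dots> = (\<Sum>j\<in>{1..n}. \<phi> j powr d)"
    using pos by (intro sum.cong refl) (simp add: powr_diff abs_of_pos less_imp_neq[THEN not_sym])
  finally show ?thesis by (simp add: \<phi>_def F_def)
qed

text \<open>Split by \<open>p = real n * c\<close>, the proportion filled by the children. For
  \<open>p\<close> near \<open>1\<close> the previous lemma gives a gain
  \<open>exp \<kappa>\<close>; otherwise \<open>p\<close> stays away from \<open>1\<close>, and a
  large power of it makes the left side smaller than the contribution of one child.\<close>

lemma subdivision_image_mass_uniform: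
  assumes d: "0 < d" "d < 1"
  obtains \<kappa> L where "0 < \<kappa>" "0 < L"
    "\<And>n c u x y. subdivision n c u x y \<Longrightarrow> n \<le> N \<Longrightarrow>
       exp \<kappa> * (real n * c) powr L * (f y - f x) powr d
         \<le> (\<Sum>j\<in>{1..n}. (f (u j + c * (y - x)) - f (u j)) powr d)"
proof (cases "N \<ge> 2")
  case False
  \<comment> \<open>A subdivision has at least two pieces, so there is nothing to prove for
    \<open>N < 2\<close>.\<close>
  show thesis by (rule that[of 1 1]) (use False in \<open>auto simp: subdivision_def\<close>)
next
  case True
  obtain C \<Lambda> where C: "0 < C" "0 \<le> \<Lambda>" and
    sub_ge: "\<And>x u v y. x \<le> u \<Longrightarrow> u < v \<Longrightarrow> v \<le> y \<Longrightarrow>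
        C * ((v - u) / (y - x)) powr \<Lambda> * (f y - f x) \<le> f v - f u"
    using subinterval_image_ge_powr by metis
  \<comment> \<open>When \<open>p \<ge> 1 / 2\<close>, each child has relative length at least
    \<open>1 / (2 * real N)\<close>; hence this lower bound for the proportion of its image.\<close>
  define \<beta> where "\<beta> = min (1/2) (C * (1 / (2 * real N)) powr \<Lambda>)"
  have \<beta>: "0 < \<beta>" "\<beta> < 1" using C True by (auto simp: \<beta>_def)
  define Q where "Q = (1 - \<beta>) powr (d - 1)"
  have "1 powr (d - 1) < (1 - \<beta>) powr (d - 1)"
    using \<beta> d by (intro powr_less_mono2_neg) auto
  then have Q: "1 < Q" by (simp add: Q_def)
  \<comment> \<open>Half of the gain \<open>ln Q\<close> is kept as \<open>\<kappa>\<close>; the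
    other half pays for the factor \<open>1 - \<gamma> = exp (- \<kappa>)\<close> lost in the
    gaps.\<close>
  define \<kappa> where "\<kappa> = ln Q / 2"
  have \<kappa>: "0 < \<kappa>" using Q by (simp add: \<kappa>_def)
  have exp\<kappa>: "exp \<kappa> = exp (- \<kappa>) * Q"
  proof -
    have "exp \<kappa> = exp (- \<kappa>) * exp (ln Q)"
      unfolding exp_add[symmetric] by (simp add: \<kappa>_def)
    then show ?thesis using Q by simp
  qed
  define \<gamma> where "\<gamma> = 1 - exp (- \<kappa>)"
  have \<gamma>: "0 < \<gamma>" using \<kappa> by (simp add: \<gamma>_def)
  have "(\<lambda>m. real (N + 1) * (M / (M + 1)) ^ m) \<longlonglongrightarrow> real (N + 1) * 0"
    using M_ge_1 by (intro tendsto_intros LIMSEQ_power_zero) auto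
  then have "\<forall>\<^sub>F m in sequentially. real (N + 1) * (M / (M + 1)) ^ m < \<gamma>"
    by (rule order_tendstoD) (use \<gamma> in simp)
  then obtain m where m: "real (N + 1) * (M / (M + 1)) ^ m \<le> \<gamma>"
    using eventually_happens'[OF sequentially_bot] less_imp_le by blast
  define \<epsilon> where "\<epsilon> = min (1 / 2) (1 / 3 ^ m :: real)"
  have \<epsilon>: "0 < \<epsilon>" "\<epsilon> \<le> 1 / 2" "3 ^ m * \<epsilon> \<le> 1" by (auto simp: \<epsilon>_def min_def field_simps)
  define A where "A = (C * (1 / real N) powr \<Lambda>) powr d"
  have A: "0 < A" using C True by (simp add: A_def)
  \<comment> \<open>One child contributes \<open>A * p powr (\<Lambda> * d)\<close> relative to the
    parent. The second summand is an exponent that pushes every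
    \<open>p \<le> 1 - \<epsilon>\<close> below \<open>A * exp (- \<kappa>)\<close>, and the last
    one makes \<open>L\<close> positive.\<close>
  define L where "L = \<Lambda> * d + max 0 ((\<kappa> - ln A) / - ln (1 - \<epsilon>)) + 1"
  have L: "0 < L" using C d by (simp add: L_def add_nonneg_pos)
  have goal: "exp \<kappa> * (real n * c) powr L * (f y - f x) powr d
         \<le> (\<Sum>j\<in>{1..n}. (f (u j + c * (y - x)) - f (u j)) powr d)"
    if sub: "subdivision n c u x y" and "n \<le> N" for n c u x y
  proof -
    have "x < y" "2 \<le> n" "0 < c" using sub by (auto simp: subdivision_def)
    have F: "0 < f y - f x" using f_less[OF \<open>x < y\<close>] by simp
    define p where "p = real n * c"
    have p: "0 < p" "p \<le> 1"
      using subdivision_gaps[OF sub] \<open>2 \<le> n\<close> \<open>0 < c\<close> by (auto simp: p_def)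
    have c_ge: "p / real N \<le> c"
      using \<open>n \<le> N\<close> \<open>0 < c\<close> True by (simp add: p_def field_simps)
    have piece: "C * (q / real N) powr \<Lambda> * (f y - f x) \<le> f (u j + c * (y - x)) - f (u j)"
      if "j \<in> {1..n}" "0 < q" "q \<le> p" for j q
    proof -
      have "C * c powr \<Lambda> * (f y - f x) \<le> f (u j + c * (y - x)) - f (u j)"
        using sub_ge[of x "u j" "u j + c * (y - x)" y] subdivision_bounds[OF sub that(1)]
          \<open>x < y\<close> \<open>0 < c\<close> by simp
      moreover have "(q / real N) powr \<Lambda> \<le> c powr \<Lambda>"
        using that True c_ge C by (intro powr_mono2) (auto simp: field_simps intro: order_trans)
      then have "C * (q / real N) powr \<Lambda> * (f y - f x) \<le> C * c powr \<Lambda> * (f y - f x)"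
        using F C by (intro mult_right_mono mult_left_mono) auto
      ultimately show ?thesis by linarith
    qed
    show ?thesis
    proof (cases "1 - \<epsilon> < p")
      case True
      have "3 ^ m * (1 - p) \<le> 3 ^ m * \<epsilon>" using True by simp
      then have "3 ^ m * (1 - p) \<le> 1" using \<epsilon>(3) by linarith
      then have "3 ^ m * (1 - real n * c) \<le> 1" by (simp add: p_def)
      moreover have "\<beta> * (f y - f x) \<le> f (u j + c * (y - x)) - f (u j)" if "j \<in> {1..n}" for j
      proof -
        have "\<beta> * (f y - f x) \<le> C * (1 / (2 * real N)) powr \<Lambda> * (f y - f x)"
          using F by (intro mult_right_mono) (auto simp: \<beta>_def)
        also have "\<dots> \<le> f (u j + c * (y - x)) - f (u j)"
          using piece[OF that, of "1 / 2"] True \<epsilon> by simp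
        finally show ?thesis .
      qed
      ultimately have "(1 - \<gamma>) * Q * (f y - f x) powr d
         \<le> (\<Sum>j\<in>{1..n}. (f (u j + c * (y - x)) - f (u j)) powr d)"
        unfolding Q_def using sub \<open>n \<le> N\<close> \<beta> m d by (intro subdivision_image_mass) auto
      moreover have "(1 - \<gamma>) * Q = exp \<kappa>" using exp\<kappa> by (simp add: \<gamma>_def)
      ultimately have mass: "exp \<kappa> * (f y - f x) powr d
         \<le> (\<Sum>j\<in>{1..n}. (f (u j + c * (y - x)) - f (u j)) powr d)" by simp
      have "p powr L \<le> 1" using p L by (simp add: powr_le1)
      then have "exp \<kappa> * p powr L * (f y - f x) powr d \<le> exp \<kappa> * 1 * (f y - f x) powr d"
        by (intro mult_right_mono mult_left_mono) auto
      with mass show ?thesis unfolding p_def mult_1_right by (rule order_trans[rotated])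
    next
      case False
      \<comment> \<open>Here the first child alone suffices: the surplus exponent of
        \<open>p\<close> pays for \<open>exp \<kappa> / A\<close>.\<close>
      let ?r = "(\<kappa> - ln A) / - ln (1 - \<epsilon>)"
      have l\<epsilon>: "ln (1 - \<epsilon>) < 0" using \<epsilon> by simp
      have lp: "ln p \<le> ln (1 - \<epsilon>)" using False p by simp
      have "max 0 ?r * ln p \<le> max 0 ?r * ln (1 - \<epsilon>)"
        using lp by (intro mult_left_mono) auto
      also have "\<dots> \<le> ?r * ln (1 - \<epsilon>)" using l\<epsilon> by (intro mult_right_mono_neg) auto
      also have "\<dots> = ln A - \<kappa>" using l\<epsilon> by (simp add: field_simps)
      finally have "max 0 ?r * ln p \<le> ln A - \<kappa>" .
      moreover have "ln p \<le> 0" using p by simp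
      ultimately have "\<kappa> + L * ln p \<le> ln A + \<Lambda> * d * ln p"
        unfolding L_def distrib_right mult_1_left by linarith
      then have "exp (\<kappa> + L * ln p) \<le> exp (ln A + \<Lambda> * d * ln p)" by simp
      then have "exp \<kappa> * p powr L \<le> A * p powr (\<Lambda> * d)"
        using p A by (simp add: exp_add powr_def)
      then have "exp \<kappa> * p powr L * (f y - f x) powr d \<le> A * p powr (\<Lambda> * d) * (f y - f x) powr d"
        by (intro mult_right_mono) auto
      also have "\<dots> = (C * (p / real N) powr \<Lambda> * (f y - f x)) powr d"
        using C p F True by (simp add: A_def powr_mult powr_divide powr_powr)
      also have "\<dots> \<le> (f (u 1 + c * (y - x)) - f (u 1)) powr d"
        using piece[of 1 p] \<open>2 \<le> n\<close> p C F d by (intro powr_mono2) auto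
      also have "\<dots> \<le> (\<Sum>j\<in>{1..n}. (f (u j + c * (y - x)) - f (u j)) powr d)"
        using \<open>2 \<le> n\<close> by (intro member_le_sum) auto
      finally show ?thesis by (simp add: p_def)
    qed
  qed
  show thesis by (rule that[OF \<kappa> L goal])
qed

end

section \<open>Words and level sets\<close>

lemma words_0: "words n 0 = {[]}"
  by (auto simp: words_def)

lemma words_Suc: "words n (Suc k) = (\<lambda>(\<sigma>, j). \<sigma> @ [j]) ` (words n k \<times> {1..n (Suc k)})"
proof (intro equalityI subsetI)
  fix \<tau> assume \<tau>: "\<tau> \<in> words n (Suc k)"
  then obtain \<sigma> j where *: "\<tau> = \<sigma> @ [j]"
    by (cases \<tau> rule: rev_cases) (auto simp: words_def)
  have "\<sigma> \<in> words n k"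
    unfolding words_def
  proof (safe; -)
    show "length \<sigma> = k" using \<tau> * by (simp add: words_def)
    fix i assume "i < k"
    have "\<tau> ! i \<in> {1..n (Suc i)}" using \<tau> \<open>i < k\<close> by (auto simp: words_def)
    then show "\<sigma> ! i \<in> {1..n (Suc i)}"
      using * \<open>i < k\<close> \<open>length \<sigma> = k\<close> by (simp add: nth_append)
  qed
  moreover have "\<tau> ! k \<in> {1..n (Suc k)}" using \<tau> by (auto simp: words_def)
  then have "j \<in> {1..n (Suc k)}" using * \<open>\<sigma> \<in> words n k\<close> by (auto simp: words_def)
  ultimately show "\<tau> \<in> (\<lambda>(\<sigma>, j). \<sigma> @ [j]) ` (words n k \<times> {1..n (Suc k)})" using * by auto
next
  fix \<tau> assume "\<tau> \<in> (\<lambda>(\<sigma>, j). \<sigma> @ [j]) ` (words n k \<times> {1..n (Suc k)})"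
  then show "\<tau> \<in> words n (Suc k)"
    by (auto simp: words_def nth_append less_Suc_eq)
qed

lemma words_SucE:
  assumes "\<tau> \<in> words n (Suc k)"
  obtains \<sigma> j where "\<tau> = \<sigma> @ [j]" "\<sigma> \<in> words n k" "j \<in> {1..n (Suc k)}"
  using assms by (auto simp: words_Suc)

lemma inj_on_snoc: "inj_on (\<lambda>(\<sigma>, j). \<sigma> @ [j]) A"
  by (auto simp: inj_on_def)

lemma finite_words: "finite (words n k)"
  by (induction k) (auto simp: words_0 words_Suc)

lemma sum_words_Suc:
  "(\<Sum>\<tau>\<in>words n (Suc k). g \<tau>) = (\<Sum>\<sigma>\<in>words n k. \<Sum>j\<in>{1..n (Suc k)}. g (\<sigma> @ [j]))"
  unfolding words_Suc
  by (subst sum.reindex[OF inj_on_snoc]) (simp add: sum.cartesian_product split_def)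

lemma card_words: "card (words n k) = (\<Prod>i\<in>{1..k}. n i)"
  by (induction k) (simp_all add: words_0 words_Suc card_image[OF inj_on_snoc] card_cartesian_product mult.commute)

section \<open>Lengths, separation and compactness of the level intervals\<close>

context homogeneous_perfect_structure
begin

text \<open>The common length of all level \<open>k\<close> intervals, as \<open>J_eq\<close>
  confirms; so \<open>Inf (J \<sigma>)\<close> and the level determine
  \<open>J \<sigma>\<close>.\<close>

definition len :: "nat \<Rightarrow> real" where
  "len k = (\<Prod>i\<in>{1..k}. c i)"

lemma len_0 [simp]: "len 0 = 1"
  by (simp add: len_def)

lemma len_Suc [simp]: "len (Suc k) = c (Suc k) * len k"
  by (simp add: len_def mult.commute)

lemma len_pos: "0 < len k"
  using c_bounds by (auto simp: len_def intro!: prod_pos)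

lemma J_eq: "\<sigma> \<in> words n k \<Longrightarrow> J \<sigma> = {Inf (J \<sigma>)..Inf (J \<sigma>) + len k}"
proof (induction k arbitrary: \<sigma>)
  case 0
  then show ?case by (simp add: words_0 J_Nil)
next
  case (Suc k)
  from Suc.prems obtain \<tau> j where \<tau>: "\<sigma> = \<tau> @ [j]" "\<tau> \<in> words n k" "j \<in> {1..n (Suc k)}"
    by (rule words_SucE)
  from J_interval[OF Suc.prems] obtain a b where ab: "a \<le> b" "J \<sigma> = {a..b}" by blast
  have "measure lborel (J \<tau>) = len k"
    by (subst Suc.IH[OF \<tau>(2)]) (simp add: len_pos less_imp_le)
  then have "(b - a) / len k = c (Suc k)"
    using J_ratio[OF \<tau>(2,3)] \<tau>(1) ab by simp
  then have "b - a = len (Suc k)"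
    using len_pos[of k] by (simp add: field_simps)
  then show ?case using ab by simp
qed

lemma J_subdivision:
  assumes "\<sigma> \<in> words n k"
  shows "subdivision (n (Suc k)) (c (Suc k)) (\<lambda>j. Inf (J (\<sigma> @ [j]))) (Inf (J \<sigma>)) (Inf (J \<sigma>) + len k)"
proof -
  have child: "\<sigma> @ [j] \<in> words n (Suc k)" if "j \<in> {1..n (Suc k)}" for j
    using assms that by (auto simp: words_Suc)
  have sub: "Inf (J \<sigma>) \<le> Inf (J (\<sigma> @ [j])) \<and> Inf (J (\<sigma> @ [j])) + len (Suc k) \<le> Inf (J \<sigma>) + len k"
    if "j \<in> {1..n (Suc k)}" for j
  proof -
    have "{Inf (J (\<sigma> @ [j]))..Inf (J (\<sigma> @ [j])) + len (Suc k)} \<subseteq> {Inf (J \<sigma>)..Inf (J \<sigma>) + len k}"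
      using J_subset[OF assms that] J_eq[OF assms] J_eq[OF child[OF that]] by simp
    then show ?thesis using len_pos[of "Suc k"] by simp
  qed
  have "Inf (J (\<sigma> @ [j])) + len (Suc k) \<le> Inf (J (\<sigma> @ [Suc j]))" if "j \<in> {1..<n (Suc k)}" for j
  proof -
    have "Sup (J (\<sigma> @ [j])) = Inf (J (\<sigma> @ [j])) + len (Suc k)"
      using len_pos[of "Suc k"] that
      by (subst J_eq[OF child]) (auto simp del: len_Suc)
    then show ?thesis using J_ordered[OF assms that] by simp
  qed
  then show ?thesis
    using sub n_ge_2[of "Suc k"] c_bounds[of "Suc k"] len_pos[of k] by (auto simp: subdivision_def)
qed

text \<open>For different parents, the left ends of the parents are \<open>len k\<close> apart by
  induction, and a child starts at most \<open>len k - len (Suc k)\<close> after its parent.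
  Siblings are handled by \<open>subdivision_ordered\<close>.\<close>

lemma words_separated:
  assumes "\<sigma> \<in> words n k" "\<tau> \<in> words n k" "\<sigma> \<noteq> \<tau>"
  shows "len k \<le> \<bar>Inf (J \<sigma>) - Inf (J \<tau>)\<bar>"
  using assms
proof (induction k arbitrary: \<sigma> \<tau>)
  case 0
  then show ?case by (simp add: words_0)
next
  case (Suc k)
  from Suc.prems(1) obtain \<sigma>' i where \<sigma>: "\<sigma> = \<sigma>' @ [i]" "\<sigma>' \<in> words n k" "i \<in> {1..n (Suc k)}"
    by (rule words_SucE)
  from Suc.prems(2) obtain \<tau>' j where \<tau>: "\<tau> = \<tau>' @ [j]" "\<tau>' \<in> words n k" "j \<in> {1..n (Suc k)}"
    by (rule words_SucE)
  note b1 = subdivision_bounds[OF J_subdivision[OF \<sigma>(2)] \<sigma>(3)]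
  note b2 = subdivision_bounds[OF J_subdivision[OF \<tau>(2)] \<tau>(3)]
  show ?case
  proof (cases "\<sigma>' = \<tau>'")
    case True
    then have "i < j \<or> j < i" using Suc.prems \<sigma> \<tau> by auto
    then show ?thesis
      using subdivision_ordered[OF J_subdivision[OF \<sigma>(2)], of i j]
        subdivision_ordered[OF J_subdivision[OF \<sigma>(2)], of j i] \<sigma> \<tau> True by auto
  next
    case False
    then have "len k \<le> \<bar>Inf (J \<sigma>') - Inf (J \<tau>')\<bar>" using Suc.IH \<sigma> \<tau> by blast
    then show ?thesis using b1 b2 \<sigma>(1) \<tau>(1) by (auto simp: abs_if split: if_splits)
  qed
qed

text \<open>The left ends of the intervals in question lie in a window of length at most
  \<open>2 * len k\<close> and are \<open>len k\<close> apart, so their positions in units of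
  \<open>len k\<close> have distinct floors, among \<open>-1\<close> and \<open>0\<close>.\<close>

lemma card_words_meeting_le_2:
  assumes "b - a \<le> len k"
  shows "card {\<sigma> \<in> words n k. J \<sigma> \<inter> {a<..<b} \<noteq> {}} \<le> 2"
proof -
  let ?W = "{\<sigma> \<in> words n k. J \<sigma> \<inter> {a<..<b} \<noteq> {}}"
  define g where "g \<sigma> = \<lfloor>(Inf (J \<sigma>) - a) / len k\<rfloor>" for \<sigma>
  have "inj_on g ?W"
  proof (rule inj_onI, rule ccontr)
    fix \<sigma> \<tau> assume "\<sigma> \<in> ?W" "\<tau> \<in> ?W" "g \<sigma> = g \<tau>" "\<sigma> \<noteq> \<tau>"
    then have "1 \<le> \<bar>Inf (J \<sigma>) - Inf (J \<tau>)\<bar> / len k"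
      using words_separated[of \<sigma> k \<tau>] len_pos[of k] by (simp add: field_simps)
    also have "\<dots> = \<bar>(Inf (J \<sigma>) - a) / len k - (Inf (J \<tau>) - a) / len k\<bar>"
      using len_pos[of k] by (simp add: diff_divide_distrib[symmetric] abs_divide)
    finally show False using \<open>g \<sigma> = g \<tau>\<close> unfolding g_def by linarith
  qed
  moreover have "g ` ?W \<subseteq> {-1, 0}"
  proof
    fix i assume "i \<in> g ` ?W"
    then obtain \<sigma> where \<sigma>: "\<sigma> \<in> words n k" "J \<sigma> \<inter> {a<..<b} \<noteq> {}" "i = g \<sigma>" by auto
    then obtain x where x: "x \<in> J \<sigma>" "a < x" "x < b" by auto
    have "Inf (J \<sigma>) \<le> x" "x \<le> Inf (J \<sigma>) + len k" using x(1) J_eq[OF \<sigma>(1)] by auto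
    then have "(- 1) * len k \<le> Inf (J \<sigma>) - a" "Inf (J \<sigma>) - a < 1 * len k" using x assms by auto
    then have "- 1 \<le> (Inf (J \<sigma>) - a) / len k" "(Inf (J \<sigma>) - a) / len k < 1"
      using len_pos[of k] by (simp_all add: field_simps)
    then have "- 1 \<le> g \<sigma>" "g \<sigma> < 1" unfolding g_def by linarith+
    then show "i \<in> {-1, 0}" using \<sigma>(3) by auto
  qed
  ultimately have "card ?W \<le> card {-1, 0 :: int}"
    by (intro card_inj_on_le) auto
  then show ?thesis by simp
qed

lemma ratio_le_1: "1 \<le> k \<Longrightarrow> real (n k) * c k \<le> 1"
proof (induction k)
  case (Suc k)
  \<comment> \<open>Any word of length \<open>k\<close> would do; this one shows that there is
    one.\<close>
  define \<sigma> where "\<sigma> = replicate k (1::nat)"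
  have "1 \<le> n (Suc j)" for j using n_ge_2[of "Suc j"] by simp
  then have "\<sigma> \<in> words n k" by (simp add: \<sigma>_def words_def)
  from subdivision_gaps[OF J_subdivision[OF this]] show ?case by blast
qed simp

lemma len_le: "len k \<le> (1 / 2) ^ k"
proof (induction k)
  case (Suc k)
  have "2 * c (Suc k) \<le> real (n (Suc k)) * c (Suc k)"
    using n_ge_2[of "Suc k"] c_bounds[of "Suc k"] by (intro mult_right_mono) auto
  also have "\<dots> \<le> 1" by (rule ratio_le_1) simp
  finally have "c (Suc k) \<le> 1 / 2" by simp
  then have "c (Suc k) * len k \<le> (1 / 2) * (1 / 2) ^ k"
    using Suc.IH len_pos[of k] by (intro mult_mono) auto
  then show ?case by simp
qed simp

lemma len_tendsto_0: "len \<longlonglongrightarrow> 0"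
  using len_le len_pos
  by (intro tendsto_sandwich[OF _ _ tendsto_const LIMSEQ_power_zero[of "1 / 2 :: real"]])
     (auto simp: less_imp_le)

lemma level_set_antimono: "j \<le> k \<Longrightarrow> level_set n J k \<subseteq> level_set n J j"
proof (induction rule: dec_induct)
  case (step k)
  have "level_set n J (Suc k) \<subseteq> level_set n J k"
    unfolding level_set_def using J_subset by (force elim!: words_SucE)
  then show ?case using step by blast
qed simp

lemma compact_level_set: "compact (level_set n J k)"
  unfolding level_set_def
proof (rule compact_UN[OF finite_words])
  fix \<sigma> assume "\<sigma> \<in> words n k"
  then show "compact (J \<sigma>)" using J_eq by (metis compact_Icc)
qed

lemma compact_perfect_set: "compact (homogeneous_perfect_set n J)"
  unfolding homogeneous_perfect_set_def
  by (rule compact_Inter) (auto simp: compact_level_set)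

text \<open>The level sets minus \<open>U\<close> are compact and decreasing with empty
  intersection, so one of them is empty, and then all later ones are.\<close>

lemma level_set_subset_open:
  assumes "open U" "homogeneous_perfect_set n J \<subseteq> U"
  obtains k0 where "\<And>k. k0 \<le> k \<Longrightarrow> level_set n J k \<subseteq> U"
proof -
  have "\<exists>k0. level_set n J k0 - U = {}"
  proof (rule ccontr)
    assume "\<nexists>k0. level_set n J k0 - U = {}"
    then have "(\<Inter>k. level_set n J k - U) \<noteq> {}"
      using level_set_antimono
      by (intro compact_nest compact_diff compact_level_set \<open>open U\<close>) blast+
    then show False using assms(2) unfolding homogeneous_perfect_set_def by blast
  qed
  then show thesis using that level_set_antimono by blast
qed

text \<open>With \<open>W k\<close> words of length \<open>k\<close>, the product is
  \<open>P k = W k * len k\<close>. Were \<open>W k * len k powr s\<close> arbitrarily small at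
  arbitrarily late levels, the level covers would give \<open>hausdorff_dim E \<le> s < 1\<close>.
  So it stays above some \<open>\<epsilon>\<close>, which bounds \<open>- ln (P k)\<close> by
  \<open>(1 - s) / s * ln (W k)\<close> plus a constant.\<close>

lemma ratios_subexponential:
  assumes N: "\<And>k. 1 \<le> k \<Longrightarrow> n k \<le> N"
    and dim: "hausdorff_dim (homogeneous_perfect_set n J) = 1"
    and "0 < \<theta>"
  obtains C where "\<And>k. - ln (\<Prod>i\<in>{1..k}. real (n i) * c i) \<le> \<theta> * real k + C"
proof -
  define E where "E = homogeneous_perfect_set n J"
  define P where "P k = (\<Prod>i\<in>{1..k}. real (n i) * c i)" for k
  define W where "W k = real (card (words n k))" for k
  have P_eq: "P k = W k * len k" for k
    by (simp add: P_def W_def len_def card_words prod.distrib)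
  have P_pos: "0 < P k" for k
    unfolding P_def using c_bounds n_ge_2 by (intro prod_pos) force
  have W_pos: "0 < W k" for k using P_pos[of k] len_pos[of k] by (simp add: P_eq zero_less_mult_iff)
  have "2 \<le> N" using N[of 1] n_ge_2[of 1] by simp
  then have lnN: "0 < ln (real N)" by simp
  \<comment> \<open>Solves \<open>(1 - s) / s * ln (real N) = \<theta>\<close>, where
    \<open>W k \<le> real N ^ k\<close>.\<close>
  define s where "s = ln (real N) / (\<theta> + ln (real N))"
  have s: "0 < s" "s < 1" using lnN \<open>0 < \<theta>\<close> by (auto simp: s_def)
  have "\<exists>\<epsilon>>0. \<exists>K. \<forall>k\<ge>K. \<epsilon> < W k * len k powr s"
  proof (rule ccontr)
    assume "\<not> (\<exists>\<epsilon>>0. \<exists>K. \<forall>k\<ge>K. \<epsilon> < W k * len k powr s)"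
    then have neg: "\<exists>k\<ge>K. W k * len k powr s \<le> \<epsilon>" if "0 < \<epsilon>" for \<epsilon> K
      using that by (meson not_le)
    have "hausdorff_measure s E = 0"
    proof (rule hausdorff_measure_eq_0I[where 'b = "nat list", OF s(1)])
      fix \<delta> \<epsilon> :: real assume "0 < \<delta>" "0 < \<epsilon>"
      obtain K where K: "\<And>k. K \<le> k \<Longrightarrow> len k < \<delta>"
        using order_tendstoD(2)[OF len_tendsto_0 \<open>0 < \<delta>\<close>] by (auto simp: eventually_sequentially)
      obtain k where k: "K \<le> k" "W k * len k powr s \<le> \<epsilon>" using neg[OF \<open>0 < \<epsilon>\<close>] by blast
      show "\<exists>I V l. finite (I :: nat list set) \<and> E \<subseteq> (\<Union>i\<in>I. V i) \<and>
          (\<forall>i\<in>I. bounded (V i) \<and> diameter (V i) \<le> l) \<and> 0 \<le> l \<and> l \<le> \<delta> \<and>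
          real (card I) * l powr s \<le> \<epsilon>"
      proof (intro exI conjI ballI)
        show "E \<subseteq> (\<Union>\<sigma>\<in>words n k. J \<sigma>)"
          unfolding E_def homogeneous_perfect_set_def level_set_def by blast
      next
        fix \<sigma> assume \<sigma>: "\<sigma> \<in> words n k"
        show "diameter (J \<sigma>) \<le> len k" "bounded (J \<sigma>)"
          by (subst J_eq[OF \<sigma>], use len_pos[of k] in simp)+
      qed (use k K[OF k(1)] len_pos[of k] finite_words in \<open>auto simp: W_def less_imp_le\<close>)
    qed
    then have "hausdorff_dim E \<le> ennreal s" using s by (intro hausdorff_dim_le) auto
    then show False using dim s by (simp add: E_def)
  qed
  then obtain \<epsilon> K where \<epsilon>: "0 < \<epsilon>" "\<And>k. K \<le> k \<Longrightarrow> \<epsilon> < W k * len k powr s" by blast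
  have W_le: "ln (W k) \<le> real k * ln (real N)" for k
  proof -
    have "W k \<le> (\<Prod>i\<in>{1..k}. real N)"
      unfolding W_def card_words of_nat_prod using N by (intro prod_mono) auto
    then have "ln (W k) \<le> ln (real N ^ k)"
      using W_pos[of k] \<open>2 \<le> N\<close> by (subst ln_le_cancel_iff) auto
    moreover have "ln (real N ^ k) = real k * ln (real N)"
      by (rule ln_realpow)
    ultimately show ?thesis by simp
  qed
  have large: "- ln (P k) \<le> \<theta> * real k + - ln \<epsilon> / s" if "K \<le> k" for k
  proof -
    have "ln \<epsilon> < ln (W k * len k powr s)"
      using \<epsilon> that W_pos[of k] len_pos[of k] by (subst ln_less_cancel_iff) auto
    also have "\<dots> = (1 - s) * ln (W k) + s * ln (P k)"
      using W_pos[of k] len_pos[of k] by (simp add: P_eq ln_mult ln_powr algebra_simps)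
    finally have "s * (- ln (P k)) \<le> (1 - s) * ln (W k) - ln \<epsilon>" by simp
    also have "\<dots> \<le> (1 - s) * (real k * ln (real N)) - ln \<epsilon>"
      using W_le s by (intro diff_right_mono mult_left_mono) auto
    also have "(1 - s) * (real k * ln (real N)) = s * (\<theta> * real k)"
      using lnN \<open>0 < \<theta>\<close> by (simp add: s_def field_simps)
    finally show ?thesis using s by (simp add: field_simps)
  qed
  \<comment> \<open>The sum takes care of the finitely many levels before \<open>K\<close>.\<close>
  define C where "C = \<bar>- ln \<epsilon> / s\<bar> + (\<Sum>k<K. \<bar>ln (P k)\<bar>)"
  have "- ln (P k) \<le> \<theta> * real k + C" for k
  proof (cases "K \<le> k")
    case True
    have "0 \<le> (\<Sum>k<K. \<bar>ln (P k)\<bar>)" by (intro sum_nonneg) simp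
    then show ?thesis using large[OF True] unfolding C_def by linarith
  next
    case False
    then have "\<bar>ln (P k)\<bar> \<le> (\<Sum>k<K. \<bar>ln (P k)\<bar>)" by (intro member_le_sum) auto
    moreover have "0 \<le> \<theta> * real k" using \<open>0 < \<theta>\<close> by simp
    ultimately show ?thesis unfolding C_def by linarith
  qed
  then show thesis using that unfolding P_def by blast
qed

end

section \<open>Mass distribution\<close>

context homogeneous_perfect_structure
begin

text \<open>The weight of a word is divided among its children in proportion to \<open>y\<close>, so that
  \<open>w \<sigma> / y \<sigma>\<close> gains the factor \<open>y \<sigma> / (\<Sum>j. y (\<sigma> @ [j]))\<close> at each level.\<close>

lemma exists_weights:
  fixes y :: "nat list \<Rightarrow> real"
  assumes y_pos: "\<And>\<sigma>. 0 < y \<sigma>"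
    and "0 < L"
    and step: "\<And>k \<sigma>. \<sigma> \<in> words n k \<Longrightarrow>
      exp \<kappa> * (real (n (Suc k)) * c (Suc k)) powr L * y \<sigma> \<le> (\<Sum>j\<in>{1..n (Suc k)}. y (\<sigma> @ [j]))"
    and decay: "\<And>k. - ln (\<Prod>i\<in>{1..k}. real (n i) * c i) \<le> \<kappa> / L * real k + C"
  obtains w K where "0 < K" "w [] = 1" "\<And>\<sigma>. 0 \<le> w \<sigma>"
    "\<And>k \<sigma>. \<sigma> \<in> words n k \<Longrightarrow> (\<Sum>j\<in>{1..n (Suc k)}. w (\<sigma> @ [j])) = w \<sigma>"
    "\<And>k \<sigma>. \<sigma> \<in> words n k \<Longrightarrow> w \<sigma> \<le> K * y \<sigma>"
proof
  define S where "S \<sigma> = (\<Sum>j\<in>{1..n (Suc (length \<sigma>))}. y (\<sigma> @ [j]))" for \<sigma>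
  define w where "w \<sigma> = (\<Prod>m<length \<sigma>. y (take (Suc m) \<sigma>) / S (take m \<sigma>))" for \<sigma>
  have "0 \<le> S \<sigma>" for \<sigma> unfolding S_def by (intro sum_nonneg) (simp add: y_pos less_imp_le)
  then show w_nonneg: "0 \<le> w \<sigma>" for \<sigma>
    unfolding w_def by (intro prod_nonneg) (simp add: y_pos less_imp_le)
  show "w [] = 1" by (simp add: w_def)
  have w_snoc: "w (\<sigma> @ [j]) = w \<sigma> / S \<sigma> * y (\<sigma> @ [j])" for \<sigma> j
    by (simp add: w_def)
  have S_pos: "0 < S \<sigma>" for \<sigma>
    unfolding S_def using n_ge_2[of "Suc (length \<sigma>)"] by (intro sum_pos) (auto simp: y_pos)
  have len: "length \<sigma> = k" if "\<sigma> \<in> words n k" for \<sigma> k using that by (simp add: words_def)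
  show "(\<Sum>j\<in>{1..n (Suc k)}. w (\<sigma> @ [j])) = w \<sigma>" if "\<sigma> \<in> words n k" for \<sigma> k
  proof -
    have "(\<Sum>j\<in>{1..n (Suc k)}. w (\<sigma> @ [j])) = w \<sigma> / S \<sigma> * S \<sigma>"
      unfolding w_snoc sum_distrib_left[symmetric] using len[OF that] by (simp add: S_def)
    then show ?thesis using S_pos[of \<sigma>] by simp
  qed
  define P where "P k = (\<Prod>i\<in>{1..k}. real (n i) * c i)" for k
  define q where "q k = real (n (Suc k)) * c (Suc k)" for k
  have q_pos: "0 < q k" for k
    using n_ge_2[of "Suc k"] c_bounds[of "Suc k"] by (auto simp: q_def)
  have P_Suc: "P (Suc k) = P k * q k" for k by (simp add: P_def q_def)
  have P_pos: "0 < P k" for k by (induction k) (simp_all add: P_Suc q_pos, simp add: P_def)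
  \<comment> \<open>The bound for \<open>w \<sigma> / y \<sigma>\<close> at level \<open>k\<close>:
    it starts at \<open>1 / y []\<close>, and by \<open>step\<close> each level divides it by at
    least \<open>exp \<kappa> * q k powr L\<close>.\<close>
  define B where "B k = exp (- \<kappa> * real k) * P k powr - L / y []" for k
  have B_Suc: "B (Suc k) = B k / (exp \<kappa> * q k powr L)" for k
  proof -
    have "exp (- \<kappa> * real (Suc k)) = exp (- \<kappa> * real k) / exp \<kappa>"
      unfolding exp_diff[symmetric] by (simp add: algebra_simps)
    then show ?thesis
      unfolding B_def P_Suc using P_pos[of k] q_pos[of k]
      by (simp add: powr_mult powr_minus divide_simps del: of_nat_Suc)
  qed
  have w_le: "w \<sigma> \<le> B k * y \<sigma>" if "\<sigma> \<in> words n k" for k \<sigma>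
    using that
  proof (induction k arbitrary: \<sigma>)
    case 0
    then show ?case using y_pos[of "[]"] by (simp add: words_0 w_def B_def P_def)
  next
    case (Suc k)
    from Suc.prems obtain \<tau> j where \<tau>: "\<sigma> = \<tau> @ [j]" "\<tau> \<in> words n k"
      by (rule words_SucE)
    have "exp \<kappa> * q k powr L * y \<tau> \<le> S \<tau>"
      using step[OF \<tau>(2)] len[OF \<tau>(2)] by (simp add: S_def q_def)
    moreover have "0 < exp \<kappa> * q k powr L * y \<tau>" using q_pos[of k] y_pos[of \<tau>] by simp
    ultimately have "w \<tau> / S \<tau> \<le> B k * y \<tau> / (exp \<kappa> * q k powr L * y \<tau>)"
      using Suc.IH[OF \<tau>(2)] w_nonneg[of \<tau>] by (intro frac_le) auto
    also have "\<dots> = B (Suc k)" using y_pos[of \<tau>] by (simp add: B_Suc)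
    finally show ?case
      unfolding \<tau>(1) w_snoc using y_pos[of "\<tau> @ [j]"] by (intro mult_right_mono) auto
  qed
  \<comment> \<open>The rate \<open>\<kappa> / L\<close> in \<open>decay\<close> is exactly the one
    at which \<open>P k powr - L\<close> is compensated by
    \<open>exp (- \<kappa> * real k)\<close>.\<close>
  have B_le: "B k \<le> exp (L * C) / y []" for k
  proof -
    have "L * - ln (P k) \<le> L * (\<kappa> / L * real k + C)"
      using decay[of k] \<open>0 < L\<close> unfolding P_def by (intro mult_left_mono) auto
    also have "\<dots> = \<kappa> * real k + L * C" using \<open>0 < L\<close> by (simp add: field_simps)
    finally have "exp (- \<kappa> * real k + - L * ln (P k)) \<le> exp (L * C)" by simp
    then have "exp (- \<kappa> * real k) * P k powr - L \<le> exp (L * C)"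
      using P_pos[of k] by (simp add: powr_def exp_add[symmetric])
    then show ?thesis unfolding B_def using y_pos[of "[]"] by (intro divide_right_mono) auto
  qed
  show "0 < exp (L * C) / y []" using y_pos[of "[]"] by simp
  show "w \<sigma> \<le> exp (L * C) / y [] * y \<sigma>" if "\<sigma> \<in> words n k" for k \<sigma>
    using w_le[OF that] B_le[of k] y_pos[of \<sigma>] by (meson mult_right_mono less_imp_le order_trans)
qed

end

text \<open>The weights are the masses of cylinders of a probability on the tree of words. All
  arguments take place at finite levels, so no measure on \<open>E\<close> is constructed.\<close>

locale weighted_perfect_structure = homogeneous_perfect_structure +
  fixes w :: "nat list \<Rightarrow> real"
  assumes w_Nil: "w [] = 1"
    and w_nonneg: "0 \<le> w \<sigma>"
    and w_children: "\<sigma> \<in> words n k \<Longrightarrow> (\<Sum>j\<in>{1..n (Suc k)}. w (\<sigma> @ [j])) = w \<sigma>"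
begin

text \<open>An upper estimate at level \<open>k\<close> for the mass of \<open>V\<close>; it
  improves as \<open>k\<close> grows.\<close>

definition meeting_mass :: "real set \<Rightarrow> nat \<Rightarrow> real" where
  "meeting_mass V k = (\<Sum>\<sigma>\<in>words n k. if J \<sigma> \<inter> V \<noteq> {} then w \<sigma> else 0)"

lemma sum_weights: "(\<Sum>\<sigma>\<in>words n k. w \<sigma>) = 1"
proof (induction k)
  case (Suc k)
  have "(\<Sum>\<tau>\<in>words n (Suc k). w \<tau>) = (\<Sum>\<sigma>\<in>words n k. w \<sigma>)"
    unfolding sum_words_Suc by (intro sum.cong refl w_children)
  then show ?case using Suc by simp
qed (simp add: words_0 w_Nil)

lemma meeting_mass_antimono: "j \<le> k \<Longrightarrow> meeting_mass V k \<le> meeting_mass V j"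
proof (induction rule: dec_induct)
  case (step k)
  have "meeting_mass V (Suc k) \<le> meeting_mass V k"
    unfolding meeting_mass_def sum_words_Suc
  proof (rule sum_mono)
    fix \<sigma> assume \<sigma>: "\<sigma> \<in> words n k"
    show "(\<Sum>j\<in>{1..n (Suc k)}. if J (\<sigma> @ [j]) \<inter> V \<noteq> {} then w (\<sigma> @ [j]) else 0)
        \<le> (if J \<sigma> \<inter> V \<noteq> {} then w \<sigma> else 0)"
    proof (cases "J \<sigma> \<inter> V = {}")
      case True
      then have "J (\<sigma> @ [j]) \<inter> V = {}" if "j \<in> {1..n (Suc k)}" for j
        using J_subset[OF \<sigma> that] by blast
      then show ?thesis using True by simp
    next
      case False
      have "(\<Sum>j\<in>{1..n (Suc k)}. if J (\<sigma> @ [j]) \<inter> V \<noteq> {} then w (\<sigma> @ [j]) else 0)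
          \<le> (\<Sum>j\<in>{1..n (Suc k)}. w (\<sigma> @ [j]))"
        by (intro sum_mono) (simp add: w_nonneg)
      then show ?thesis using False w_children[OF \<sigma>] by simp
    qed
  qed
  then show ?case using step by simp
qed simp

text \<open>The left end of each level interval lies in some \<open>V i\<close>, so every weight is
  counted at least once, and the weights sum to \<open>1\<close>.\<close>

lemma meeting_mass_cover:
  assumes "finite I" "level_set n J k \<subseteq> (\<Union>i\<in>I. V i)"
  shows "1 \<le> (\<Sum>i\<in>I. meeting_mass (V i) k)"
proof -
  have "w \<sigma> \<le> (\<Sum>i\<in>I. if J \<sigma> \<inter> V i \<noteq> {} then w \<sigma> else 0)" if \<sigma>: "\<sigma> \<in> words n k" for \<sigma>
  proof -
    have "Inf (J \<sigma>) \<in> J \<sigma>" by (subst (2) J_eq[OF \<sigma>]) (simp add: len_pos less_imp_le)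
    moreover have "J \<sigma> \<subseteq> level_set n J k" using \<sigma> by (auto simp: level_set_def)
    ultimately obtain i where i: "i \<in> I" "J \<sigma> \<inter> V i \<noteq> {}" using assms(2) by blast
    then have "w \<sigma> = (if J \<sigma> \<inter> V i \<noteq> {} then w \<sigma> else 0)" by simp
    also have "\<dots> \<le> (\<Sum>i\<in>I. if J \<sigma> \<inter> V i \<noteq> {} then w \<sigma> else 0)"
      by (rule member_le_sum) (use i \<open>finite I\<close> w_nonneg in auto)
    finally show ?thesis .
  qed
  then have "(\<Sum>\<sigma>\<in>words n k. w \<sigma>)
      \<le> (\<Sum>\<sigma>\<in>words n k. \<Sum>i\<in>I. if J \<sigma> \<inter> V i \<noteq> {} then w \<sigma> else 0)"
    by (rule sum_mono)
  then show ?thesis unfolding sum_weights meeting_mass_def by (subst sum.swap)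
qed

text \<open>Take the first level whose intervals are no longer than \<open>b - a\<close>. Their
  parents are longer, so at most two parents and hence at most \<open>2 * N\<close> intervals meet
  \<open>{a<..<b}\<close>, each with image comparable to that of \<open>[a, b]\<close>. Deeper
  levels follow by \<open>meeting_mass_antimono\<close>.\<close>

lemma meeting_mass_interval:
  assumes "increasing_quasisymmetric f M"
    and N: "\<And>k. 1 \<le> k \<Longrightarrow> n k \<le> N"
    and w_le: "\<And>k \<sigma>. \<sigma> \<in> words n k \<Longrightarrow> w \<sigma> \<le> K * (f (Inf (J \<sigma>) + len k) - f (Inf (J \<sigma>))) powr d"
    and "0 < K" "0 < d" "a < b"
  obtains k0 where "\<And>k. k0 \<le> k \<Longrightarrow>
    meeting_mass {a<..<b} k \<le> 2 * real N * K * (2 * (M + 1)\<^sup>2) powr d * (f b - f a) powr d"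
proof -
  interpret increasing_quasisymmetric f M by fact
  have "\<exists>k. len k \<le> b - a"
    using order_tendstoD(2)[OF len_tendsto_0, of "b - a"] \<open>a < b\<close>
    by (auto simp: eventually_sequentially intro: less_imp_le)
  define k0 where "k0 = (LEAST k. len k \<le> b - a)"
  have k0: "len k0 \<le> b - a" unfolding k0_def by (rule LeastI_ex) fact
  have before: "b - a < len k" if "k < k0" for k
    using not_less_Least[of k "\<lambda>k. len k \<le> b - a"] that by (simp add: k0_def)
  let ?W = "{\<sigma> \<in> words n k0. J \<sigma> \<inter> {a<..<b} \<noteq> {}}"
  have "2 \<le> N" using N[of 1] n_ge_2[of 1] by simp
  have "card ?W \<le> 2 * N"
  proof (cases k0)
    \<comment> \<open>At level \<open>0\<close> there is no parent, but only one word.\<close>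
    case 0
    have "card ?W \<le> card (words n 0)" unfolding 0 by (intro card_mono finite_words) auto
    then show ?thesis using \<open>2 \<le> N\<close> by (simp add: words_0)
  next
    case (Suc k)
    let ?W' = "{\<sigma> \<in> words n k. J \<sigma> \<inter> {a<..<b} \<noteq> {}}"
    have "?W \<subseteq> (\<lambda>(\<sigma>, j). \<sigma> @ [j]) ` (?W' \<times> {1..n (Suc k)})"
    proof
      fix \<tau> assume \<tau>: "\<tau> \<in> ?W"
      then have "\<tau> \<in> words n (Suc k)" using Suc by simp
      then obtain \<sigma> j where "\<tau> = \<sigma> @ [j]" "\<sigma> \<in> words n k" "j \<in> {1..n (Suc k)}"
        by (rule words_SucE)
      then show "\<tau> \<in> (\<lambda>(\<sigma>, j). \<sigma> @ [j]) ` (?W' \<times> {1..n (Suc k)})"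
        using J_subset[of \<sigma> k j] \<tau> by (intro rev_image_eqI[of "(\<sigma>, j)"]) auto
    qed
    then have "card ?W \<le> card (?W' \<times> {1..n (Suc k)})"
      by (intro surj_card_le finite_cartesian_product) (auto intro: finite_subset[OF _ finite_words])
    also have "\<dots> \<le> 2 * N"
      unfolding card_cartesian_product
      using card_words_meeting_le_2[of b a k] before[of k] Suc N[of "Suc k"]
      by (intro mult_mono) auto
    finally show ?thesis .
  qed
  have "0 < f b - f a" using f_less[OF \<open>a < b\<close>] by simp
  define Z where "Z = K * (2 * (M + 1)\<^sup>2 * (f b - f a)) powr d"
  have Z: "0 \<le> Z" using \<open>0 < K\<close> by (simp add: Z_def)
  have "w \<sigma> \<le> Z" if "\<sigma> \<in> ?W" for \<sigma>
  proof -
    have \<sigma>: "\<sigma> \<in> words n k0" using that by simp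
    from that obtain x where x: "x \<in> J \<sigma>" "a < x" "x < b" by auto
    have "Inf (J \<sigma>) \<le> x" "x \<le> Inf (J \<sigma>) + len k0" using x(1) J_eq[OF \<sigma>] by auto
    then have "f (Inf (J \<sigma>) + len k0) \<le> f (b + (b - a))" "f (a - (b - a)) \<le> f (Inf (J \<sigma>))"
      using x k0 by (intro f_le; linarith)+
    \<comment> \<open>The interval tripled about its centre contains \<open>J \<sigma>\<close>; two
      doublings suffice since \<open>3 \<le> 2\<^sup>2\<close>.\<close>
    moreover have "f (b + (b - a)) - f (a - (b - a)) \<le> 2 * (M + 1)\<^sup>2 * (f b - f a)"
      using \<open>a < b\<close> by (intro image_le_subinterval) auto
    ultimately have le: "f (Inf (J \<sigma>) + len k0) - f (Inf (J \<sigma>)) \<le> 2 * (M + 1)\<^sup>2 * (f b - f a)"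
      by linarith
    have "0 \<le> f (Inf (J \<sigma>) + len k0) - f (Inf (J \<sigma>))"
      using f_le[of "Inf (J \<sigma>)" "Inf (J \<sigma>) + len k0"] len_pos[of k0] by simp
    then have "K * (f (Inf (J \<sigma>) + len k0) - f (Inf (J \<sigma>))) powr d \<le> Z"
      unfolding Z_def using le \<open>0 < K\<close> \<open>0 < d\<close> by (intro mult_left_mono powr_mono2) auto
    then show ?thesis using w_le[OF \<sigma>] by linarith
  qed
  then have "(\<Sum>\<sigma>\<in>?W. w \<sigma>) \<le> real (card ?W) * Z" by (rule sum_bounded_above)
  also have "\<dots> \<le> real (2 * N) * Z" using \<open>card ?W \<le> 2 * N\<close> Z by (intro mult_right_mono) linarith+
  also have "\<dots> = 2 * real N * K * (2 * (M + 1)\<^sup>2) powr d * (f b - f a) powr d"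
    using \<open>0 < f b - f a\<close> M_ge_1 by (simp add: Z_def powr_mult mult_ac)
  finally have "meeting_mass {a<..<b} k0 \<le> 2 * real N * K * (2 * (M + 1)\<^sup>2) powr d * (f b - f a) powr d"
    unfolding meeting_mass_def by (simp add: sum.inter_filter finite_words)
  then show thesis using that meeting_mass_antimono order_trans by blast
qed

end

section \<open>Lower bound for the Hausdorff measure of the image\<close>

lemma double_sum_powr_le:
  fixes x y d :: real
  assumes "0 \<le> x" "0 \<le> y" "0 < d" "d \<le> 1"
  shows "(2 * (x + y)) powr d \<le> 4 * (x powr d + y powr d)"
proof -
  have "(2 * (x + y)) powr d \<le> (4 * max x y) powr d"
    using assms by (intro powr_mono2) auto
  also have "\<dots> = 4 powr d * max x y powr d"
    using assms by (simp add: powr_mult)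
  also have "\<dots> \<le> 4 powr 1 * (x powr d + y powr d)"
    using assms by (intro mult_mono powr_mono) (auto simp: max_def)
  finally show ?thesis by simp
qed

context weighted_perfect_structure
begin

text \<open>The mass distribution principle. A cover of the image is fattened to open intervals and
  pulled back by \<open>f\<close>; compactness leaves finitely many, which cover some level set.
  Their masses sum to at least \<open>1\<close> and are bounded by the powers of the
  diameters.\<close>

lemma hausdorff_measure_image_pos:
  assumes "increasing_quasisymmetric f M"
    and N: "\<And>k. 1 \<le> k \<Longrightarrow> n k \<le> N"
    and w_le: "\<And>k \<sigma>. \<sigma> \<in> words n k \<Longrightarrow> w \<sigma> \<le> K * (f (Inf (J \<sigma>) + len k) - f (Inf (J \<sigma>))) powr d"
    and "0 < K" and d: "0 < d" "d < 1" and s: "0 \<le> s" "s \<le> d"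
  shows "hausdorff_measure s (f ` homogeneous_perfect_set n J) \<noteq> 0"
proof -
  interpret increasing_quasisymmetric f M by fact
  define E where "E = homogeneous_perfect_set n J"
  define K' where "K' = 2 * real N * K * (2 * (M + 1)\<^sup>2) powr d"
  have "2 \<le> N" using N[of 1] n_ge_2[of 1] by simp
  then have K': "0 < K'" using \<open>0 < K\<close> M_ge_1 by (simp add: K'_def)
  \<comment> \<open>Chosen so that the fattening, which costs \<open>4 * K' * \<epsilon>\<close> in
    total, uses up half of the unit mass; what remains is again \<open>\<epsilon>\<close>.\<close>
  define \<epsilon> where "\<epsilon> = 1 / (8 * K')"
  have \<epsilon>: "0 < \<epsilon>" using K' by (simp add: \<epsilon>_def)
  have lower: "ennreal \<epsilon> \<le> (\<Sum>i. hausdorff_weight s (U i))" if U: "U \<in> delta_covers 1 (f ` E)" for U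
  proof -
    have cover: "f ` E \<subseteq> (\<Union>i. U i)" and bdd: "\<And>i. bounded (U i)" and diam: "\<And>i. diameter (U i) \<le> 1"
      using U by (auto simp: delta_covers_def)
    define D where "D i = diameter (U i)" for i
    have D: "0 \<le> D i" "D i \<le> 1" for i
      using bdd diam by (auto simp: D_def diameter_ge_0)
    \<comment> \<open>A positive margin, so that even one-point sets get nondegenerate open
      intervals, while the powers \<open>r i powr d\<close> sum to at most
      \<open>\<epsilon>\<close>.\<close>
    define r where "r i = (\<epsilon> * (1 / 2) ^ Suc i) powr (1 / d)" for i :: nat
    have r: "0 < r i" "r i powr d = \<epsilon> * (1 / 2) ^ Suc i" for i
      using \<epsilon> d by (auto simp: r_def powr_powr)
    define A where "A = {i. U i \<noteq> {}}"
    have "\<exists>x a b. x \<in> U i \<and> f a = x - (D i + r i) \<and> f b = x + (D i + r i)" if "i \<in> A" for i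
    proof -
      obtain x where "x \<in> U i" using \<open>i \<in> A\<close> by (auto simp: A_def)
      moreover obtain a where "f a = x - (D i + r i)" using surj by (metis surjD)
      moreover obtain b where "f b = x + (D i + r i)" using surj by (metis surjD)
      ultimately show ?thesis by blast
    qed
    then obtain x a b where xab: "\<And>i. i \<in> A \<Longrightarrow> x i \<in> U i"
        "\<And>i. i \<in> A \<Longrightarrow> f (a i) = x i - (D i + r i)" "\<And>i. i \<in> A \<Longrightarrow> f (b i) = x i + (D i + r i)"
      by metis
    define V where "V i = {a i<..<b i}" for i
    have "E \<subseteq> (\<Union>i\<in>A. V i)"
    proof
      fix z assume "z \<in> E"
      then obtain i where i: "f z \<in> U i" using cover by blast
      then have "i \<in> A" by (auto simp: A_def)
      have "dist (f z) (x i) \<le> D i"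
        unfolding D_def using i xab(1)[OF \<open>i \<in> A\<close>] bdd by (intro diameter_bounded_bound) auto
      then have "\<bar>f z - x i\<bar> < D i + r i" using r(1)[of i] by (simp add: dist_real_def)
      then have "f (a i) < f z" "f z < f (b i)" using xab(2,3)[OF \<open>i \<in> A\<close>] by linarith+
      then have "z \<in> V i" using strict_mono by (simp add: V_def strict_mono_less)
      then show "z \<in> (\<Union>i\<in>A. V i)" using \<open>i \<in> A\<close> by blast
    qed
    then obtain I where I: "I \<subseteq> A" "finite I" "E \<subseteq> (\<Union>i\<in>I. V i)"
      using compactE_image[OF compact_perfect_set, of A V] by (auto simp: V_def E_def)
    obtain k1 where k1: "\<And>k. k1 \<le> k \<Longrightarrow> level_set n J k \<subseteq> (\<Union>i\<in>I. V i)"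
      by (rule level_set_subset_open[of "\<Union>i\<in>I. V i"]) (use I(3) in \<open>auto simp: V_def E_def\<close>)
    have "\<exists>k0. \<forall>k\<ge>k0. meeting_mass (V i) k \<le> K' * (2 * (D i + r i)) powr d" if "i \<in> I" for i
    proof -
      have "i \<in> A" using that I(1) by blast
      have diff: "f (b i) - f (a i) = 2 * (D i + r i)" using xab(2,3)[OF \<open>i \<in> A\<close>] by simp
      have "0 < 2 * (D i + r i)" using D(1)[of i] r(1)[of i] by simp
      then have "f (a i) < f (b i)" using diff by simp
      then have "a i < b i" using strict_mono by (simp add: strict_mono_less)
      with assms(1) N w_le \<open>0 < K\<close> d(1) show ?thesis
        unfolding V_def K'_def diff[symmetric] by (rule meeting_mass_interval) blast+
    qed
    then obtain k0 where k0: "\<And>i k. i \<in> I \<Longrightarrow> k0 i \<le> k \<Longrightarrow>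
        meeting_mass (V i) k \<le> K' * (2 * (D i + r i)) powr d" by metis
    define k where "k = Max (insert k1 (k0 ` I))"
    have k: "k1 \<le> k" "\<And>i. i \<in> I \<Longrightarrow> k0 i \<le> k" using I(2) by (auto simp: k_def)
    then have "1 \<le> (\<Sum>i\<in>I. meeting_mass (V i) k)"
      using I(2) k1 by (intro meeting_mass_cover) auto
    also have "\<dots> \<le> (\<Sum>i\<in>I. K' * (4 * (D i powr d + r i powr d)))"
    proof (rule sum_mono)
      fix i assume i: "i \<in> I"
      have "(2 * (D i + r i)) powr d \<le> 4 * (D i powr d + r i powr d)"
        using D(1)[of i] r(1)[of i] d by (intro double_sum_powr_le) auto
      then show "meeting_mass (V i) k \<le> K' * (4 * (D i powr d + r i powr d))"
        using k0[OF i k(2)[OF i]] K' by (meson mult_left_mono less_imp_le order_trans)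
    qed
    also have "\<dots> = 4 * K' * ((\<Sum>i\<in>I. D i powr d) + (\<Sum>i\<in>I. r i powr d))"
      by (simp add: sum_distrib_left sum.distrib algebra_simps)
    also have "(\<Sum>i\<in>I. r i powr d) = \<epsilon> * (\<Sum>i\<in>I. (1 / 2) ^ Suc i)"
      by (simp only: r(2) sum_distrib_left)
    also have "(\<Sum>i\<in>I. (1 / 2 :: real) ^ Suc i) \<le> (\<Sum>i. (1 / 2) ^ Suc i)"
      using I(2) sums_summable[OF power_half_series] by (intro sum_le_suminf) auto
    also have "(\<Sum>i. (1 / 2 :: real) ^ Suc i) = 1"
      using sums_unique[OF power_half_series] by simp
    finally have "1 \<le> 4 * K' * ((\<Sum>i\<in>I. D i powr d) + \<epsilon>)" using K' \<epsilon> by simp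
    then have "\<epsilon> \<le> (\<Sum>i\<in>I. D i powr d)" using K' by (simp add: \<epsilon>_def field_simps)
    then have "ennreal \<epsilon> \<le> (\<Sum>i\<in>I. ennreal (D i powr d))" by (simp add: ennreal_leI)
    also have "\<dots> \<le> (\<Sum>i\<in>I. hausdorff_weight s (U i))"
    proof (rule sum_mono)
      fix i assume "i \<in> I"
      then have "U i \<noteq> {}" using I(1) by (auto simp: A_def)
      \<comment> \<open>Needed for \<open>s = 0\<close>, where the weight is \<open>1\<close>; for
        \<open>s > 0\<close> the diameters being at most \<open>1\<close> lets \<open>d\<close> be
        lowered to \<open>s\<close>.\<close>
      moreover have "D i powr d \<le> 1" using D d by (simp add: powr_le1)
      moreover have "D i powr d \<le> D i powr s" using D s by (intro powr_mono') auto
      ultimately show "ennreal (D i powr d) \<le> hausdorff_weight s (U i)"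
        by (auto simp: hausdorff_weight_def D_def ennreal_leI)
    qed
    also have "\<dots> \<le> (\<Sum>i. hausdorff_weight s (U i))"
      using I(2) by (intro sum_le_suminf) auto
    finally show ?thesis .
  qed
  have "ennreal \<epsilon> \<le> hausdorff_premeasure s 1 (f ` E)"
    unfolding hausdorff_premeasure_def using lower by (rule INF_greatest)
  also have "\<dots> \<le> hausdorff_measure s (f ` E)"
    unfolding hausdorff_measure_def by (rule SUP_upper) simp
  finally show ?thesis using \<epsilon> by (auto simp: E_def)
qed

end

text \<open>The upper bound holds because the image is bounded. For the lower bound, the
  \<open>s\<close>-dimensional measure is shown to be nonzero for every
  \<open>s < 1\<close>.\<close>

lemma (in homogeneous_perfect_structure) hausdorff_dim_increasing_image:
  assumes qs: "increasing_quasisymmetric f M"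
    and N: "\<And>k. 1 \<le> k \<Longrightarrow> n k \<le> N"
    and dim: "hausdorff_dim (homogeneous_perfect_set n J) = 1"
  shows "hausdorff_dim (f ` homogeneous_perfect_set n J) = 1"
proof (rule antisym)
  interpret increasing_quasisymmetric f M by fact
  define E where "E = homogeneous_perfect_set n J"
  have "E \<subseteq> level_set n J 0" by (auto simp: E_def homogeneous_perfect_set_def)
  then have "E \<subseteq> {0..1}" by (simp add: level_set_def words_0 J_Nil)
  then have "f ` E \<subseteq> {f 0..f 1}" using f_le by auto
  then have "bounded (f ` E)" by (rule bounded_subset[OF bounded_closed_interval])
  then show "hausdorff_dim (f ` homogeneous_perfect_set n J) \<le> 1"
    unfolding E_def by (rule hausdorff_dim_bounded_real_le_1)
  have "hausdorff_measure s (f ` E) \<noteq> 0" if s: "0 \<le> s" "s < 1" for s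
  proof -
    \<comment> \<open>The midpoint lies strictly between \<open>0\<close> and \<open>1\<close> even
      for \<open>s = 0\<close>.\<close>
    define d where "d = (1 + s) / 2"
    have d: "0 < d" "d < 1" "s \<le> d" using s by (auto simp: d_def)
    obtain \<kappa> L where \<kappa>: "0 < \<kappa>" "0 < L" and mass:
      "\<And>n c u x y. subdivision n c u x y \<Longrightarrow> n \<le> N \<Longrightarrow>
         exp \<kappa> * (real n * c) powr L * (f y - f x) powr d
           \<le> (\<Sum>j\<in>{1..n}. (f (u j + c * (y - x)) - f (u j)) powr d)"
      by (rule subdivision_image_mass_uniform[OF d(1,2), where N = N]) blast
    obtain C where C: "\<And>k. - ln (\<Prod>i\<in>{1..k}. real (n i) * c i) \<le> \<kappa> / L * real k + C"
      using ratios_subexponential[OF N dim, of "\<kappa> / L"] \<kappa> by auto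
    define y where "y \<sigma> = (f (Inf (J \<sigma>) + len (length \<sigma>)) - f (Inf (J \<sigma>))) powr d" for \<sigma>
    have y_pos: "0 < y \<sigma>" for \<sigma>
      using f_less[of "Inf (J \<sigma>)" "Inf (J \<sigma>) + len (length \<sigma>)"] len_pos[of "length \<sigma>"]
      by (simp add: y_def)
    have step: "exp \<kappa> * (real (n (Suc k)) * c (Suc k)) powr L * y \<sigma>
        \<le> (\<Sum>j\<in>{1..n (Suc k)}. y (\<sigma> @ [j]))" if "\<sigma> \<in> words n k" for k \<sigma>
      using mass[OF J_subdivision[OF that] N] that by (simp add: y_def words_def)
    obtain w K where w: "0 < K" "w [] = 1" "\<And>\<sigma>. 0 \<le> w \<sigma>"
      "\<And>k \<sigma>. \<sigma> \<in> words n k \<Longrightarrow> (\<Sum>j\<in>{1..n (Suc k)}. w (\<sigma> @ [j])) = w \<sigma>"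
      and w_le: "\<And>k \<sigma>. \<sigma> \<in> words n k \<Longrightarrow> w \<sigma> \<le> K * y \<sigma>"
      by (rule exists_weights[OF y_pos \<kappa>(2) step C]) blast+
    interpret weighted_perfect_structure n c \<eta> J w
      by unfold_locales (use w in auto)
    show ?thesis unfolding E_def
      using qs N _ w(1) d(1,2) s(1) d(3)
    proof (rule hausdorff_measure_image_pos)
      fix k \<sigma> assume "\<sigma> \<in> words n k"
      then show "w \<sigma> \<le> K * (f (Inf (J \<sigma>) + len k) - f (Inf (J \<sigma>))) powr d"
        using w_le[of \<sigma> k] by (simp add: y_def words_def)
    qed
  qed
  then show "1 \<le> hausdorff_dim (f ` homogeneous_perfect_set n J)"
    unfolding hausdorff_dim_def E_def
    by (intro INF_greatest) (metis (mono_tags) mem_Collect_eq not_less ennreal_1 ennreal_leI)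
qed

section \<open>Reflection and the reduction to increasing maps\<close>

lemma diameter_uminus_image:
  fixes S :: "real set"
  shows "diameter (uminus ` S) = diameter S"
proof -
  have "(\<lambda>(x, y). dist x y) ` (uminus ` S \<times> uminus ` S) = (\<lambda>(x, y). dist x y) ` (S \<times> S)"
    by (force simp: dist_minus image_iff)
  then show ?thesis by (simp add: diameter_def)
qed

lemma hausdorff_premeasure_uminus_image_le:
  fixes A :: "real set"
  shows "hausdorff_premeasure s \<delta> (uminus ` A) \<le> hausdorff_premeasure s \<delta> A"
  unfolding hausdorff_premeasure_def
proof (rule INF_greatest)
  fix U assume U: "U \<in> delta_covers \<delta> A"
  then have "(\<lambda>i. uminus ` U i) \<in> delta_covers \<delta> (uminus ` A)"
    unfolding delta_covers_def by (simp add: diameter_uminus_image) blast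
  then have "(INF U\<in>delta_covers \<delta> (uminus ` A). \<Sum>i. hausdorff_weight s (U i))
      \<le> (\<Sum>i. hausdorff_weight s (uminus ` U i))" by (rule INF_lower)
  also have "\<dots> = (\<Sum>i. hausdorff_weight s (U i))"
    unfolding hausdorff_weight_def diameter_uminus_image by simp
  finally show "(INF U\<in>delta_covers \<delta> (uminus ` A). \<Sum>i. hausdorff_weight s (U i))
      \<le> (\<Sum>i. hausdorff_weight s (U i))" .
qed

lemma hausdorff_dim_uminus_image:
  fixes A :: "real set"
  shows "hausdorff_dim (uminus ` A) = hausdorff_dim A"
proof -
  have "hausdorff_premeasure s \<delta> (uminus ` A) = hausdorff_premeasure s \<delta> A" for s \<delta>
    using hausdorff_premeasure_uminus_image_le[of s \<delta> A]
      hausdorff_premeasure_uminus_image_le[of s \<delta> "uminus ` A"]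
    by (intro antisym) (simp_all add: image_image)
  then show ?thesis by (simp add: hausdorff_dim_def hausdorff_measure_def)
qed

text \<open>A continuous injection of the line is strictly monotone, and negating a decreasing one
  preserves the lengths of images of intervals.\<close>

lemma quasisymmetric_cases:
  assumes "quasisymmetric f"
  obtains g M where "increasing_quasisymmetric g M" "f = g \<or> f = (\<lambda>x. - g x)"
proof -
  from assms obtain M f' where M: "1 \<le> M" and hom: "homeomorphism UNIV UNIV f f'" and
    ratio: "\<And>I J. adjacent_intervals I J \<Longrightarrow> measure lborel I = measure lborel J \<Longrightarrow>
        inverse M \<le> measure lborel (f ` I) / measure lborel (f ` J) \<and>
        measure lborel (f ` I) / measure lborel (f ` J) \<le> M"
    unfolding quasisymmetric_def M_quasisymmetric_def by blast
  have cont: "continuous_on UNIV f" and surj: "surj f" and "inj f"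
    using hom by (auto simp: homeomorphism_def inj_on_def) metis
  then have "strict_mono f \<or> strict_antimono_on UNIV f"
    using injective_eq_monotone_map[OF is_interval_univ cont] by simp
  then obtain g where g: "strict_mono g" "f = g \<or> f = (\<lambda>x. - g x)"
  proof
    assume "strict_antimono_on UNIV f"
    then show thesis using that[of "\<lambda>x. - f x"] by (auto simp: monotone_on_def)
  qed (use that in auto)
  have surj_g: "surj g"
  proof -
    have "range f = range g \<or> range f = uminus ` range g" using g(2) by (auto simp: image_image)
    then have "range g = UNIV \<or> uminus ` range g = UNIV" using surj by metis
    then show ?thesis
      by (metis (no_types, lifting) UNIV_eq_I UNIV_I image_iff minus_minus neg_equal_iff_equal)
  qed
  have image_g: "g ` {a..b} = {g a..g b}" for a b
  proof
    show "{g a..g b} \<subseteq> g ` {a..b}"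
    proof
      fix y assume y: "y \<in> {g a..g b}"
      obtain x where "y = g x" using surj_g by blast
      with y g(1) show "y \<in> g ` {a..b}" by (auto simp: strict_mono_less_eq)
    qed
  qed (use g(1) in \<open>auto simp: strict_mono_less_eq\<close>)
  have meas: "measure lborel (f ` {a..b}) = g b - g a" if "a \<le> b" for a b
  proof -
    have "g a \<le> g b" using g(1) that by (simp add: strict_mono_less_eq)
    moreover have "f ` {a..b} = {g a..g b} \<or> f ` {a..b} = {- g b..- g a}"
      using g(2) image_g[of a b] by (metis image_image image_uminus_atLeastAtMost)
    ultimately show ?thesis by auto
  qed
  have "increasing_quasisymmetric g M"
  proof
    fix h a :: real assume h: "0 < h"
    have pos: "0 < g (a + h) - g a" "0 < g (a + 2 * h) - g (a + h)"
      using g(1) h by (simp_all add: strict_mono_less)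
    \<comment> \<open>Both inequalities come from this one pair, by the two bounds on the
      quotient.\<close>
    have "adjacent_intervals {a..a + h} {a + h..a + 2 * h}"
      using h by (simp add: adjacent_intervals_def nondegenerate_interval_def is_interval_cc)
    from ratio[OF this] have "inverse M \<le> (g (a + h) - g a) / (g (a + 2 * h) - g (a + h))"
      "(g (a + h) - g a) / (g (a + 2 * h) - g (a + h)) \<le> M"
      using h by (simp_all add: meas)
    then show "g (a + 2 * h) - g (a + h) \<le> M * (g (a + h) - g a)"
      "g (a + h) - g a \<le> M * (g (a + 2 * h) - g (a + h))"
      using pos M by (simp_all add: field_simps)
  qed (use g M surj_g in auto)
  with g(2) show thesis using that by blast
qed

theorem theorem2:
  fixes n :: "nat \<Rightarrow> nat" and c :: "nat \<Rightarrow> real" and \<eta> :: "nat \<Rightarrow> nat \<Rightarrow> real"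
    and J :: "nat list \<Rightarrow> real set" and E :: "real set" and f :: "real \<Rightarrow> real"
  assumes "homogeneous_perfect_structure n c \<eta> J"
    and "E = homogeneous_perfect_set n J"
    and "\<exists>N. \<forall>k\<ge>1. n k \<le> N"
    and "hausdorff_dim E = 1"
    and "quasisymmetric f"
  shows "hausdorff_dim (f ` E) = 1"
proof -
  interpret homogeneous_perfect_structure n c \<eta> J by fact
  obtain N where N: "\<And>k. 1 \<le> k \<Longrightarrow> n k \<le> N" using assms(3) by blast
  obtain g M where g: "increasing_quasisymmetric g M" "f = g \<or> f = (\<lambda>x. - g x)"
    using assms(5) by (rule quasisymmetric_cases)
  have "hausdorff_dim (g ` E) = 1"
    using hausdorff_dim_increasing_image[OF g(1) N] assms(2,4) by simp
  moreover have "f ` E = g ` E \<or> f ` E = uminus ` g ` E"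
    using g(2) by (auto simp: image_image)
  ultimately show ?thesis using hausdorff_dim_uminus_image[of "g ` E"] by metis
qed

end
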